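(* Let $K=\mathbb{R}$ or $K=\mathbb{C}$, let $1\le n\le 5$ with $n=p+q$, $p,q\in\mathbb{N}$, and let $Cl_n$ be the Clifford algebra over $K$. Then each of the following maps is a determinant for $Cl_n$ into $K$: - $n=1,2$: $\alpha\mapsto\alpha\mu(\alpha)$ and $\alpha\mapsto\mu(\alpha)\alpha$; - $n=3$: $\alpha\mapsto \alpha\mu(\alpha)\,\nu(\alpha\mu(\alpha))$, $\alpha\mapsto\nu(\mu(\alpha)\alpha)\,\mu(\alpha)\alpha$, $\alpha\mapsto\alpha\nu(\alpha)\,\mu(\alpha\nu(\alpha))$, and $\alpha\mapsto\mu(\nu(\alpha)\alpha)\,\nu(\alpha)\alpha$; - $n=4$: $\alpha\mapsto\alpha\mu(\alpha)\,\psi_4(\alpha\mu(\alpha))$, $\alpha\mapsto\psi_4(\mu(\alpha)\alpha)\,\mu(\alpha)\alpha$, $\alpha\mapsto\alpha\nu(\alpha)\,\psi_4(\alpha\nu(\alpha))$, and $\alpha\mapsto\psi_4(\nu(\alpha)\alpha)\,\nu(\alpha)\alpha$; - $n=5$: $\alpha\mapsto\alpha\nu(\alpha)\,\psi_5(\alpha\nu(\alpha))\,\mu\bigl(\alpha\nu(\alpha)\,\psi_5(\alpha\nu(\alpha))\bigr)$ and $\alpha\mapsto\mu\bigl(\psi_5(\nu(\alpha)\alpha)\,\nu(\alpha)\alpha\bigr)\,\psi_5(\nu(\alpha)\alpha)\,\nu(\alpha)\alpha$.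
   Context: Clifford algebra: $Cl_n$ (with $n=p+q$) is the unital associative $K$-algebra with $K$-basis $\{1\}\cup\{e_{i_1}e_{i_2}\cdots e_{i_s} : 1\le i_1<i_2<\cdots<i_s\le n\}$ and relations $e_ie_j+e_je_i=0$ for $i\ne j$, $e_i^2=-1$ for $1\le i\le p$, $e_i^2=1$ for $p+1\le i\le n$. $K$ is identified with $K\cdot1$. The following are $K$-linear maps $Cl_n\to Cl_n$, given on the basis elements with $1\le i_1<\cdots<i_s\le n$ (for $s=0$ the basis element is $1$, which is fixed by all of them). Clifford conjugation: $\mu(e_{i_1}\cdots e_{i_s})=(-1)^s e_{i_s}e_{i_{s-1}}\cdots e_{i_1}$. Reversion conjugation: $\nu(e_{i_1}\cdots e_{i_s})=e_{i_s}e_{i_{s-1}}\cdots e_{i_1}$. On $Cl_4$: $\psi_4(1)=1$ and $\psi_4(e_{i_1}\cdots e_{i_s})=-e_{i_1}\cdots e_{i_s}$ for $s=1,2,3,4$. On $Cl_5$: $\psi_5(1)=1$, $\psi_5(e_{i_1}\cdots e_{i_s})=-e_{i_1}\cdots e_{i_s}$ for $s=1,2,3,4$, and $\psi_5(e_1e_2e_3e_4e_5)=e_1e_2e_3e_4e_5$. Determinant: for a finite dimensional unital algebra $A$ over $K$, consider polynomial functions $D$ on $A$ (polynomials in the coordinates with respect to a $K$-basis of $A$) such that for all $\alpha,\beta\in A$: (1) $D(\alpha)\in K$; (2) $D(\alpha\beta)=D(\alpha)D(\beta)$; (3) $\alpha$ is invertible in $A$ if and only if $D(\alpha)$ is invertible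 in $K$. A determinant for $A$ into $K$ is such a $D$ whose degree is least among all polynomial functions with properties (1)–(3). *)

theory Defs
  imports Complex_Main
begin

definition is_invertible :: "'b::monoid_mult \<Rightarrow> bool" where
  "is_invertible x \<longleftrightarrow> (\<exists>y. x * y = 1 \<and> y * x = 1)"


section \<open>Determinants of finite-dimensional algebras\<close>

locale finite_dimensional_algebra = finite_dimensional_vector_space scale Basis
  for scale :: "'k::field \<Rightarrow> 'a::ring_1 \<Rightarrow> 'a" and Basis :: "'a set" +
  assumes scale_mult_left: "scale c x * y = scale c (x * y)"
    and scale_mult_right: "x * scale c y = scale c (x * y)"
begin

text \<open>
  Polynomials in the coordinates with respect to \<open>Basis\<close>. An exponent vector \<open>m \<in> M\<close> stands for
  the monomial with exponent \<open>m b\<close> in the coordinate belonging to \<open>b\<close>. Neither the set of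
  polynomial functions nor the degree depends on the choice of the basis.
\<close>

definition polynomial_function_deg_le :: "nat \<Rightarrow> ('a \<Rightarrow> 'k) \<Rightarrow> bool" where
  "polynomial_function_deg_le d f \<longleftrightarrow>
    (\<exists>(M :: ('a \<Rightarrow> nat) set) (c :: ('a \<Rightarrow> nat) \<Rightarrow> 'k).
      finite M \<and> (\<forall>m\<in>M. (\<Sum>b\<in>Basis. m b) \<le> d) \<and>
      (\<forall>x. f x = (\<Sum>m\<in>M. c m * (\<Prod>b\<in>Basis. representation Basis x b ^ m b))))"

definition polynomial_function :: "('a \<Rightarrow> 'k) \<Rightarrow> bool" where
  "polynomial_function f \<longleftrightarrow> (\<exists>d. polynomial_function_deg_le d f)"

text \<open>
  Over an infinite field a polynomial is determined by its polynomial function, so this is the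
  total degree of the polynomial (with value \<open>0\<close> for the zero function).
\<close>

definition polynomial_function_degree :: "('a \<Rightarrow> 'k) \<Rightarrow> nat" where
  "polynomial_function_degree f = (LEAST d. polynomial_function_deg_le d f)"

definition determinant_like :: "('a \<Rightarrow> 'k) \<Rightarrow> bool" where
  "determinant_like D \<longleftrightarrow>
    polynomial_function D \<and>
    (\<forall>\<alpha> \<beta>. D (\<alpha> * \<beta>) = D \<alpha> * D \<beta>) \<and>
    (\<forall>\<alpha>. is_invertible \<alpha> \<longleftrightarrow> is_invertible (D \<alpha>))"

definition is_determinant :: "('a \<Rightarrow> 'k) \<Rightarrow> bool" where
  "is_determinant D \<longleftrightarrow>
    determinant_like D \<and>
    (\<forall>D'. determinant_like D' \<longrightarrow> polynomial_function_degree D \<le> polynomial_function_degree D')"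

text \<open>
  The same notion for a map given with values in the algebra: all its values have to lie in the
  scalar line spanned by \<open>1\<close>, which is identified with the field.
\<close>

definition is_determinant_map :: "('a \<Rightarrow> 'a) \<Rightarrow> bool" where
  "is_determinant_map F \<longleftrightarrow> (\<exists>D. is_determinant D \<and> (\<forall>\<alpha>. F \<alpha> = scale (D \<alpha>) 1))"

end


section \<open>Clifford algebras\<close>

text \<open>
  For \<open>S = {i\<^sub>1 < \<dots> < i\<^sub>s}\<close> these are the products of the \<open>e i\<close> with \<open>i \<in> S\<close> in increasing
  and in decreasing order; both are \<open>1\<close> for \<open>S = {}\<close>.
\<close>

definition blade :: "(nat \<Rightarrow> 'a::ring_1) \<Rightarrow> nat set \<Rightarrow> 'a" where
  "blade e S = prod_list (map e (sorted_list_of_set S))"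

definition reversed_blade :: "(nat \<Rightarrow> 'a::ring_1) \<Rightarrow> nat set \<Rightarrow> 'a" where
  "reversed_blade e S = prod_list (map e (rev (sorted_list_of_set S)))"

text \<open>
  The algebra structure on \<open>'a\<close> is the Clifford algebra with generators \<open>e 1, \<dots>, e (p + q)\<close>;
  the values of \<open>e\<close> at other indices are irrelevant. The assumption on injectivity, together with
  the set of blades being a basis, says that the \<open>2 ^ (p + q)\<close> blades are distinct basis vectors.
\<close>

locale clifford_algebra =
  finite_dimensional_algebra scale "blade e ` Pow {1..p + q}"
  for scale :: "'k::field \<Rightarrow> 'a::ring_1 \<Rightarrow> 'a" and e :: "nat \<Rightarrow> 'a" and p q :: nat +
  assumes inj_blade: "inj_on (blade e) (Pow {1..p + q})"
    and anticommute: "\<lbrakk>i \<in> {1..p + q}; j \<in> {1..p + q}; i \<noteq> j\<rbrakk> \<Longrightarrow> e i * e j + e j * e i = 0"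
    and square_negative: "i \<in> {1..p} \<Longrightarrow> e i * e i = - 1"
    and square_positive: "i \<in> {p + 1..p + q} \<Longrightarrow> e i * e i = 1"
begin

text \<open>The linear map taking the value \<open>g S\<close> at the basis vector \<open>blade e S\<close>.\<close>

definition extend_linearly :: "(nat set \<Rightarrow> 'a) \<Rightarrow> 'a \<Rightarrow> 'a" where
  "extend_linearly g x =
    (\<Sum>S\<in>Pow {1..p + q}.
      scale (representation (blade e ` Pow {1..p + q}) x (blade e S)) (g S))"

definition clifford_conj :: "'a \<Rightarrow> 'a" where
  "clifford_conj = extend_linearly (\<lambda>S. (- 1) ^ card S * reversed_blade e S)"

definition reversion :: "'a \<Rightarrow> 'a" where
  "reversion = extend_linearly (reversed_blade e)"

text \<open>\<open>psi4\<close> is meant for \<open>p + q = 4\<close> and \<open>psi5\<close> for \<open>p + q = 5\<close>.\<close>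

definition psi4 :: "'a \<Rightarrow> 'a" where
  "psi4 = extend_linearly (\<lambda>S. if S = {} then blade e S else - blade e S)"

definition psi5 :: "'a \<Rightarrow> 'a" where
  "psi5 = extend_linearly (\<lambda>S. if S = {} \<or> S = {1..5} then blade e S else - blade e S)"

end

end

(*
  For n <= 3 the element alpha * mu alpha is central, which makes it multiplicative in alpha. For n = 4
  (with mu or nu) and n = 5 (with nu) the elements x fixed by the conjugation satisfy a quadratic equation
  over the center: with tau the projection to the center and psi x = 2 * tau x - x, the element
  Q x = x * psi x is central. As Q x = 2 (tau x)^2 - tau (x^2) and tau (x * y) = tau (y * x), the value
  Q (alpha * y * nu alpha) depends on alpha only through s = nu alpha * alpha, and equals Q y * Q s. So
  alpha |-> Q (alpha * nu alpha) is multiplicative. For n = 3 and n = 5 one finally multiplies by the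
  conjugate under the involution that changes the sign of the pseudoscalar.

  For the degree: if E is idempotent, then t |-> D (1 - E + t E) is a multiplicative polynomial, so it
  is t^c with c >= 1. Each of the k = (n + 1) div 2 commuting blades e_1, e_2 e_3, e_4 e_5 with square 1
  (up to a scalar factor) splits an idempotent in two and the exponents add up. If -1 is not a square in K,
  then a blade w with square -1 forces all exponents to be even, and for the later blades u with u^2 = -1
  one uses w u, whose square is 1. So D t = t^c with c >= 2^k.
*)
theory Submission
  imports Defs "HOL-Computational_Algebra.Polynomial"
begin

section \<open>Norms from quadratic traces\<close>

text \<open>The quadratic equation rests on one fact about blades: among the noncentral blades that
  a conjugation fixes, any two distinct ones anticommute or have a central product, so the square of
  a fixed element without central part is central. This fails for \<open>clifford_conj\<close> with
  five generators, which is why only \<open>reversion\<close> occurs there. The map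
  \<open>2 * \<tau> x - x\<close> sends \<open>x\<close> to its conjugate over the center;
  \<open>psi4\<close> and \<open>psi5\<close> are this map written as signs. For odd
  \<open>p + q\<close> the center is spanned by 1 and the pseudoscalar. The last conjugation must
  negate the pseudoscalar: \<open>reversion\<close> does so for three generators,
  \<open>clifford_conj\<close> for five. \<open>\<alpha> * conjugation s \<alpha>\<close> has degree
  2; \<open>quad\<close> and the norm from the center double the degree, which gives 2, 2, 4, 4, 8.
  The lower bound has to reach the same numbers in every signature. Only squares and commutation of
  a few blades enter, so no classification as matrix rings over reals, complexes or quaternions is
  involved. Splitting is useful only if both halves are nonzero; the coefficient of 1 certifies
  this, since it vanishes on all nonempty products of the chosen blades.\<close>

locale quadratic_involution =
  fixes \<tau> \<nu> :: "'a::ring_1 \<Rightarrow> 'a"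
  assumes trace_add: "\<tau> (x + y) = \<tau> x + \<tau> y"
    and trace_one: "\<tau> 1 = 1"
    and trace_central: "\<tau> x * y = y * \<tau> x"
    and trace_linear: "\<tau> (\<tau> x * y) = \<tau> x * \<tau> y"
    and trace_commute: "\<tau> (x * y) = \<tau> (y * x)"
    and involution_mult: "\<nu> (x * y) = \<nu> y * \<nu> x"
    and involution_involution: "\<nu> (\<nu> x) = x"
    and trace_quadratic: "\<nu> x = x \<Longrightarrow> \<tau> (x * (2 * \<tau> x - x)) = x * (2 * \<tau> x - x)"
begin

text \<open>For fixed \<open>x\<close> this is the norm of a quadratic extension of the center, with
  \<open>2 * \<tau> x - x\<close> as the conjugate root. As \<open>\<tau> 1 = 1\<close>,
  \<open>\<tau>\<close> is half the usual trace, hence the factors 2.\<close>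

definition quad :: "'a \<Rightarrow> 'a" where
  "quad x = x * (2 * \<tau> x - x)"

lemma trace_zero: "\<tau> 0 = 0"
  using trace_add[of 0 0] by simp

lemma trace_minus: "\<tau> (- x) = - \<tau> x"
  using trace_add[of x "- x"] trace_zero by (simp add: eq_neg_iff_add_eq_0 add.commute)

lemma trace_diff: "\<tau> (x - y) = \<tau> x - \<tau> y"
  using trace_add[of x "- y"] trace_minus by simp

lemma trace_trace: "\<tau> (\<tau> x) = \<tau> x"
  using trace_linear[of x 1] trace_one by simp

lemma central_if_trace: "\<tau> z = z \<Longrightarrow> z * x = x * z"
  using trace_central[of z x] by simp

lemma trace_scale: "\<tau> z = z \<Longrightarrow> \<tau> (z * x) = z * \<tau> x"
  using trace_linear[of z x] by simp

lemma trace_fixed_mult: "\<tau> z = z \<Longrightarrow> \<tau> w = w \<Longrightarrow> \<tau> (z * w) = z * w"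
  by (simp add: trace_scale)

lemma trace_two: "\<tau> 2 = 2"
  using trace_add[of 1 1] trace_one by simp

text \<open>A rearrangement of the definition of \<open>quad\<close>, valid for every
  \<open>x\<close>. It is a quadratic equation over the center only when \<open>quad x\<close> is
  central, which \<open>trace_quadratic\<close> grants for fixed \<open>x\<close>.\<close>

lemma square_eq: "x * x = 2 * \<tau> x * x - quad x"
  by (simp add: quad_def algebra_simps trace_central mult_2 mult_2_right)

text \<open>For fixed \<open>x\<close>, \<open>quad x\<close> is its own trace, so applying
  \<open>\<tau>\<close> loses nothing. In this form cyclicity of the trace can be used.\<close>

lemma quad_eq_traces:
  assumes "\<nu> x = x"
  shows "quad x = 2 * \<tau> x * \<tau> x - \<tau> (x * x)"
proof -
  have "quad x = \<tau> (quad x)"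
    using trace_quadratic[OF assms] by (simp add: quad_def)
  also have "\<dots> = \<tau> (2 * \<tau> x * x - x * x)"
    by (simp add: square_eq)
  finally show ?thesis
    by (simp add: trace_diff trace_scale trace_fixed_mult trace_two trace_trace)
qed

text \<open>The quadratic equation of \<open>x + y\<close> minus those of \<open>x\<close> and
  \<open>y\<close>. Fixed elements need not commute; this rule exchanges them at the cost of terms
  of lower degree.\<close>

lemma polarization:
  assumes "\<nu> x = x" "\<nu> y = y" "\<nu> (x + y) = x + y"
  shows "x * y = 2 * \<tau> x * y + 2 * \<tau> y * x - (4 * \<tau> x * \<tau> y - 2 * \<tau> (x * y)) - y * x"
proof -
  have sq: "(x + y) * (x + y) = 2 * (\<tau> x + \<tau> y) * (x + y) - quad (x + y)"
    using square_eq[of "x + y"] by (simp add: trace_add)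
  have "quad (x + y) - quad x - quad y = 4 * \<tau> x * \<tau> y - 2 * \<tau> (x * y)"
    using trace_commute[of y x] trace_central[of y "\<tau> x"]
    by (simp add: quad_eq_traces assms trace_add algebra_simps flip: mult_2)
  then have q: "quad (x + y) = 4 * \<tau> x * \<tau> y - 2 * \<tau> (x * y) + quad x + quad y"
    by (simp add: algebra_simps)
  show ?thesis
    using sq square_eq[of x] square_eq[of y] unfolding q by (simp add: algebra_simps)
qed

text \<open>
  The right-hand side of \<open>quad_eq_traces\<close> for \<open>\<alpha> * y * \<nu> \<alpha>\<close> depends on \<open>\<alpha>\<close> only through
  \<open>s = \<nu> \<alpha> * \<alpha>\<close>, because \<open>\<tau>\<close> is cyclic; so the claim becomes an identity for \<open>y\<close> and \<open>s\<close>.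
\<close>

lemma quad_mult:
  assumes add: "\<And>x y. \<nu> (x + y) = \<nu> x + \<nu> y" and y: "\<nu> y = y"
  shows "quad (\<alpha> * y * \<nu> \<alpha>) = quad y * quad (\<nu> \<alpha> * \<alpha>)"
proof -
  define s where "s = \<nu> \<alpha> * \<alpha>"
  have s: "\<nu> s = s"
    by (simp add: s_def involution_mult involution_involution)
  \<comment> \<open>All five are central. By \<open>quad_eq_traces\<close> and cyclicity the goal
    becomes \<open>\<tau> ((y * s) * (y * s)) = 2 * (t * t) - q * r\<close>.\<close>
  define a b q r t where "a = \<tau> y" and "b = \<tau> s" and "q = quad y" and "r = quad s"
    and "t = \<tau> (y * s)"
  have fixed: "\<tau> a = a" "\<tau> b = b" "\<tau> q = q" "\<tau> r = r" "\<tau> t = t"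
    using trace_quadratic[OF y] trace_quadratic[OF s]
    by (simp_all add: a_def b_def q_def r_def t_def trace_trace quad_def)
  note central = fixed[THEN central_if_trace]
  have left: "x * (a * z) = a * (x * z)" "x * (b * z) = b * (x * z)" "x * (q * z) = q * (x * z)"
    "x * (r * z) = r * (x * z)" "x * (t * z) = t * (x * z)" for x z
    by (metis central mult.assoc)+
  have two: "x * (2 * z) = 2 * (x * z)" for x z :: 'a
    by (simp add: mult_2 distrib_left)
  have four: "2 * (2 * z) = 4 * z" for z :: 'a
    by (simp flip: mult.assoc)
  have yy: "y * y = 2 * (a * y) - q" and ss: "s * s = 2 * (b * s) - r"
    using square_eq[of y] square_eq[of s] by (simp_all add: a_def b_def q_def r_def mult.assoc)
  have ys: "y * s = 2 * (a * s) + 2 * (b * y) - (4 * (a * b) - 2 * t) - s * y"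
    using polarization[OF y s] by (simp add: add y s a_def b_def t_def mult.assoc)
  have t2: "\<tau> (2 * x) = 2 * \<tau> x" for x
    by (simp add: trace_add mult_2)
  have t4: "\<tau> (4 * x) = 4 * \<tau> x" for x
  proof -
    have "4 * x = 2 * (2 * x)" for x :: 'a
      by (simp flip: mult.assoc)
    then show ?thesis by (simp only: t2)
  qed
  note tr = trace_add trace_diff t2 t4 fixed[THEN trace_scale] fixed
  have tsy: "\<tau> (s * y) = t"
    using trace_commute[of s y] by (simp only: t_def)
  have "y * (s * s) = 2 * (b * (y * s)) - r * y"
    by (simp only: ss right_diff_distrib two[of y] left[of y] central(4)[of y])
  then have tyss: "\<tau> (y * (s * s)) = 2 * (b * t) - a * r"
    by (simp add: tr central(4)[of a] flip: t_def a_def)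
  have "s * (y * y) = 2 * (a * (s * y)) - q * s"
    by (simp only: yy right_diff_distrib two[of s] left[of s] central(3)[of s])
  then have tsyy: "\<tau> (s * (y * y)) = 2 * (a * t) - b * q"
    by (simp add: tr tsy central(3)[of b] flip: b_def)
  have "(y * y) * (s * s) = 4 * (a * (b * (y * s))) - 2 * (a * (r * y)) - 2 * (b * (q * s)) + q * r"
    by (simp only: yy ss right_diff_distrib left_diff_distrib mult.assoc left[of y] two[of y] two[of a] two[of b]
        two[of q] four central(4)[of y] left(2)[of q]) simp
  then have tyyss: "\<tau> ((y * y) * (s * s)) = 4 * (a * (b * t)) - 2 * (a * (r * a)) - 2 * (b * (q * b)) + q * r"
    by (simp add: tr flip: t_def a_def b_def)
  \<comment> \<open>Only the first factor is polarized. In every remaining word of length three or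
    four a cyclic shift makes equal letters adjacent, so that \<open>yy\<close> and
    \<open>ss\<close> apply.\<close>
  have "(y * s) * (y * s) = 2 * (a * (s * (y * s))) + 2 * (b * (y * (y * s)))
      - (4 * (a * (b * (y * s))) - 2 * (t * (y * s))) - s * (y * (y * s))"
    by (subst (1) ys) (simp only: distrib_right left_diff_distrib mult.assoc)
  then have "\<tau> ((y * s) * (y * s)) = 2 * (a * \<tau> (s * (y * s))) + 2 * (b * \<tau> (y * (y * s)))
      - (4 * (a * (b * t)) - 2 * (t * t)) - \<tau> (s * (y * (y * s)))"
    by (simp add: tr flip: t_def)
  also have "\<tau> (s * (y * s)) = \<tau> (y * (s * s))"
    using trace_commute[of s "y * s"] by (simp add: mult.assoc)
  also have "\<tau> (y * (y * s)) = \<tau> (s * (y * y))"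
    using trace_commute[of "y * y" s] by (simp add: mult.assoc)
  also have "\<tau> (s * (y * (y * s))) = \<tau> ((y * y) * (s * s))"
    using trace_commute[of s "y * (y * s)"] by (simp add: mult.assoc)
  finally have "\<tau> ((y * s) * (y * s)) = 2 * (t * t) - q * r"
    unfolding tyss tsyy tyyss
    by (simp add: right_diff_distrib two[of a] two[of b] four central(4)[of a] central(3)[of b] left(1)[of b])
  moreover have "\<tau> (\<alpha> * y * \<nu> \<alpha>) = t"
    using trace_commute[of \<alpha> "y * \<nu> \<alpha>"] by (simp add: t_def s_def mult.assoc)
  moreover have "\<tau> ((\<alpha> * y * \<nu> \<alpha>) * (\<alpha> * y * \<nu> \<alpha>)) = \<tau> ((y * s) * (y * s))"
    using trace_commute[of \<alpha> "y * \<nu> \<alpha> * (\<alpha> * y * \<nu> \<alpha>)"] by (simp add: s_def mult.assoc)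
  moreover have "\<nu> (\<alpha> * y * \<nu> \<alpha>) = \<alpha> * y * \<nu> \<alpha>"
    by (simp add: involution_mult involution_involution y mult.assoc)
  ultimately show ?thesis
    by (simp add: quad_eq_traces q_def r_def s_def mult.assoc)
qed

end

section \<open>Polynomial functions\<close>

context finite_dimensional_algebra
begin

abbreviation coordinate :: "'a \<Rightarrow> 'a \<Rightarrow> 'k" where
  "coordinate \<equiv> representation Basis"

lemma coordinate_add: "coordinate (x + y) b = coordinate x b + coordinate y b"
  by (simp add: representation_add independent_Basis span_Basis)

lemma coordinate_scale: "coordinate (scale c x) b = c * coordinate x b"
  by (simp add: representation_scale independent_Basis span_Basis)

lemma coordinate_sum: "coordinate (\<Sum>i\<in>I. f i) b = (\<Sum>i\<in>I. coordinate (f i) b)"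
  by (simp add: representation_sum independent_Basis span_Basis)

lemma coordinate_expansion: "(\<Sum>b\<in>Basis. scale (coordinate x b) b) = x"
  by (rule sum_representation_eq) (simp_all add: independent_Basis span_Basis finite_Basis)

text \<open>The definition sums over a set of exponent vectors, so a monomial cannot occur twice.
  Collecting coefficients of equal vectors permits any finite index set, in particular disjoint
  unions for sums and pairs for products.\<close>

lemma polynomial_function_deg_leI:
  fixes m :: "'i \<Rightarrow> 'a \<Rightarrow> nat"
  assumes "finite I" and deg: "\<And>i. i \<in> I \<Longrightarrow> (\<Sum>b\<in>Basis. m i b) \<le> d"
    and f: "\<And>x. f x = (\<Sum>i\<in>I. c i * (\<Prod>b\<in>Basis. coordinate x b ^ m i b))"
  shows "polynomial_function_deg_le d f"
  unfolding polynomial_function_deg_le_def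
proof (intro exI conjI allI ballI)
  show "finite (m ` I)"
    using assms(1) by simp
  show "(\<Sum>b\<in>Basis. k b) \<le> d" if "k \<in> m ` I" for k
    using that deg by auto
  show "f x = (\<Sum>k\<in>m ` I. (\<Sum>i\<in>{i \<in> I. m i = k}. c i) * (\<Prod>b\<in>Basis. coordinate x b ^ k b))" for x
    unfolding f by (subst sum.image_gen[OF assms(1), of _ m])
      (auto intro!: sum.cong simp: sum_distrib_right)
qed

lemma polynomial_function_deg_le_zero: "polynomial_function_deg_le d (\<lambda>_. 0)"
  by (rule polynomial_function_deg_leI[of "{}"]) simp_all

lemma polynomial_function_deg_le_coordinate:
  assumes "b \<in> Basis"
  shows "polynomial_function_deg_le 1 (\<lambda>x. coordinate x b)"
proof (rule polynomial_function_deg_leI[of "{()}" "\<lambda>_ b'. if b' = b then 1 else 0" _ _ "\<lambda>_. 1"])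
  have "(\<Prod>b'\<in>Basis. coordinate x b' ^ (if b' = b then 1 else 0)) =
      (\<Prod>b'\<in>Basis. if b' = b then coordinate x b' else 1)" for x
    by (rule prod.cong) auto
  then show "coordinate x b = (\<Sum>i\<in>{()}. 1 * (\<Prod>b'\<in>Basis. coordinate x b' ^ (if b' = b then 1 else 0)))" for x
    using assms finite_Basis by simp
qed (use assms finite_Basis in auto)

lemma polynomial_function_deg_le_add:
  assumes "polynomial_function_deg_le d f" "polynomial_function_deg_le d g"
  shows "polynomial_function_deg_le d (\<lambda>x. f x + g x)"
proof -
  from assms(1) obtain M c where f: "finite M" "\<And>m. m \<in> M \<Longrightarrow> (\<Sum>b\<in>Basis. m b) \<le> d"
    "\<And>x. f x = (\<Sum>m\<in>M. c m * (\<Prod>b\<in>Basis. coordinate x b ^ m b))"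
    unfolding polynomial_function_deg_le_def by blast
  from assms(2) obtain N c' where g: "finite N" "\<And>m. m \<in> N \<Longrightarrow> (\<Sum>b\<in>Basis. m b) \<le> d"
    "\<And>x. g x = (\<Sum>m\<in>N. c' m * (\<Prod>b\<in>Basis. coordinate x b ^ m b))"
    unfolding polynomial_function_deg_le_def by blast
  show ?thesis
  proof (rule polynomial_function_deg_leI[of "M <+> N" "case_sum id id" _ _ "case_sum c c'"])
    show "f x + g x = (\<Sum>i\<in>M <+> N. case_sum c c' i * (\<Prod>b\<in>Basis. coordinate x b ^ case_sum id id i b))" for x
      by (simp add: sum.Plus f(1) g(1) f(3) g(3))
  qed (use f(1,2) g(1,2) in auto)
qed

lemma polynomial_function_deg_le_mult:
  assumes "polynomial_function_deg_le d f" "polynomial_function_deg_le d' g"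
  shows "polynomial_function_deg_le (d + d') (\<lambda>x. f x * g x)"
proof -
  from assms(1) obtain M c where f: "finite M" "\<And>m. m \<in> M \<Longrightarrow> (\<Sum>b\<in>Basis. m b) \<le> d"
    "\<And>x. f x = (\<Sum>m\<in>M. c m * (\<Prod>b\<in>Basis. coordinate x b ^ m b))"
    unfolding polynomial_function_deg_le_def by blast
  from assms(2) obtain N c' where g: "finite N" "\<And>m. m \<in> N \<Longrightarrow> (\<Sum>b\<in>Basis. m b) \<le> d'"
    "\<And>x. g x = (\<Sum>m\<in>N. c' m * (\<Prod>b\<in>Basis. coordinate x b ^ m b))"
    unfolding polynomial_function_deg_le_def by blast
  show ?thesis
  proof (rule polynomial_function_deg_leI[of "M \<times> N" "\<lambda>(m, m') b. m b + m' b" _ _ "\<lambda>(m, m'). c m * c' m'"])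
    show "f x * g x = (\<Sum>i\<in>M \<times> N. (case i of (m, m') \<Rightarrow> c m * c' m') *
        (\<Prod>b\<in>Basis. coordinate x b ^ (case i of (m, m') \<Rightarrow> \<lambda>b. m b + m' b) b))" for x
      unfolding f g sum_product sum.cartesian_product
      by (intro sum.cong refl) (clarsimp simp: power_add prod.distrib)
  qed (use f(1,2) g(1,2) in \<open>auto simp: sum.distrib intro!: add_mono\<close>)
qed

lemma polynomial_function_deg_le_const_mult:
  assumes "polynomial_function_deg_le d f"
  shows "polynomial_function_deg_le d (\<lambda>x. c * f x)"
proof -
  have "polynomial_function_deg_le 0 (\<lambda>_. c)"
    by (rule polynomial_function_deg_leI[of "{()}" "\<lambda>_ _. 0" _ _ "\<lambda>_. c"]) auto
  from polynomial_function_deg_le_mult[OF this assms] show ?thesis by simp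
qed

lemma polynomial_function_deg_le_sum:
  assumes "\<And>i. i \<in> I \<Longrightarrow> polynomial_function_deg_le d (f i)"
  shows "polynomial_function_deg_le d (\<lambda>x. \<Sum>i\<in>I. f i x)"
  using assms
  by (induction I rule: infinite_finite_induct)
    (auto intro!: polynomial_function_deg_le_zero polynomial_function_deg_le_add)

lemma polynomial_function_degree_le:
  "polynomial_function_deg_le d f \<Longrightarrow> polynomial_function_degree f \<le> d"
  unfolding polynomial_function_degree_def by (rule Least_le)

lemma polynomial_function_deg_le_degree:
  "polynomial_function f \<Longrightarrow> polynomial_function_deg_le (polynomial_function_degree f) f"
  unfolding polynomial_function_def polynomial_function_degree_def by (metis LeastI)

text \<open>The factors of the determinant maps take values in the algebra. Degrees are therefore
  tracked coordinatewise, until the coordinate of 1 is extracted from the final scalar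
  product.\<close>

definition polynomial_map_deg_le :: "nat \<Rightarrow> ('a \<Rightarrow> 'a) \<Rightarrow> bool" where
  "polynomial_map_deg_le d F \<longleftrightarrow> (\<forall>b\<in>Basis. polynomial_function_deg_le d (\<lambda>x. coordinate (F x) b))"

lemma polynomial_map_deg_le_id: "polynomial_map_deg_le 1 (\<lambda>x. x)"
  unfolding polynomial_map_deg_le_def using polynomial_function_deg_le_coordinate by blast

lemma polynomial_map_deg_le_linear:
  assumes "polynomial_map_deg_le d F"
    and L: "\<And>x y. L (x + y) = L x + L y" "\<And>c x. L (scale c x) = scale c (L x)"
  shows "polynomial_map_deg_le d (\<lambda>x. L (F x))"
proof -
  have 0: "L 0 = 0"
    using L(2)[of 0 0] by simp
  have sum: "L (sum f I) = (\<Sum>i\<in>I. L (f i))" for f and I :: "'a set"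
    by (induction I rule: infinite_finite_induct) (simp_all add: L 0)
  have eq: "coordinate (L x) b = (\<Sum>b'\<in>Basis. coordinate (L b') b * coordinate x b')" for x b
  proof -
    have "coordinate (L (\<Sum>b'\<in>Basis. scale (coordinate x b') b')) b =
        (\<Sum>b'\<in>Basis. coordinate (L b') b * coordinate x b')"
      by (simp add: sum L coordinate_sum coordinate_scale mult.commute)
    then show ?thesis
      by (simp only: coordinate_expansion)
  qed
  show ?thesis
    using assms(1) unfolding polynomial_map_deg_le_def eq[of "F _"]
    by (intro ballI polynomial_function_deg_le_sum polynomial_function_deg_le_const_mult) blast
qed

text \<open>Multiplication is bilinear with the structure constants
  \<open>coordinate (b' * b'') b\<close>.\<close>

lemma polynomial_map_deg_le_mult:
  assumes "polynomial_map_deg_le d F" "polynomial_map_deg_le d' G"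
  shows "polynomial_map_deg_le (d + d') (\<lambda>x. F x * G x)"
proof -
  have eq: "coordinate (x * y) b =
      (\<Sum>b'\<in>Basis. \<Sum>b''\<in>Basis. coordinate (b' * b'') b * (coordinate x b' * coordinate y b''))" for x y b
  proof -
    have "coordinate ((\<Sum>b'\<in>Basis. scale (coordinate x b') b') * (\<Sum>b'\<in>Basis. scale (coordinate y b') b')) b =
        (\<Sum>b'\<in>Basis. \<Sum>b''\<in>Basis. coordinate (b' * b'') b * (coordinate x b' * coordinate y b''))"
      by (simp add: sum_product coordinate_sum coordinate_scale scale_mult_left scale_mult_right
          mult.commute mult.left_commute)
    then show ?thesis
      by (simp only: coordinate_expansion)
  qed
  show ?thesis
    using assms unfolding polynomial_map_deg_le_def eq[of "F _" "G _"]
    by (intro ballI polynomial_function_deg_le_sum polynomial_function_deg_le_const_mult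
        polynomial_function_deg_le_mult) blast+
qed

end

text \<open>Characteristic 0 makes a polynomial determined by its values and permits the factor 1 /
  2 in the idempotents.\<close>

locale finite_dimensional_algebra_char_0 = finite_dimensional_algebra scale Basis
  for scale :: "'k::field_char_0 \<Rightarrow> 'a::ring_1 \<Rightarrow> 'a" and Basis :: "'a set"

text \<open>With \<open>s\<close> fixed, both sides are polynomials in \<open>t\<close>; comparing
  leading coefficients gives \<open>poly P s = s ^ degree P\<close>.\<close>

lemma multiplicative_poly_eq_monom:
  fixes P :: "'k::field_char_0 poly"
  assumes "P \<noteq> 0" and "\<And>s t. poly P (s * t) = poly P s * poly P t"
  shows "P = monom 1 (degree P)"
proof -
  let ?n = "degree P"
  have "poly P s = s ^ ?n" for s
  proof -
    have "poly (pcompose P [:0, s:]) t = poly (smult (poly P s) P) t" for t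
      using assms(2)[of s t] by (simp add: poly_pcompose mult.commute)
    then have "pcompose P [:0, s:] = smult (poly P s) P"
      by (intro poly_eq_poly_eq_iff[THEN iffD1] ext)
    then have "coeff (pcompose P [:0, s:]) ?n = poly P s * lead_coeff P"
      by simp
    then show ?thesis
      using assms(1) by (simp add: coeff_pcompose_linear)
  qed
  then show ?thesis
    by (intro poly_eq_poly_eq_iff[THEN iffD1] ext) (simp add: poly_monom)
qed

section \<open>A lower bound for the degree\<close>

lemma is_invertible_field_iff: "is_invertible (x :: 'k::field) \<longleftrightarrow> x \<noteq> 0"
proof
  assume "x \<noteq> 0"
  then show "is_invertible x"
    unfolding is_invertible_def by (intro exI[of _ "inverse x"]) simp
qed (auto simp: is_invertible_def)

context finite_dimensional_algebra_char_0
begin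

text \<open>Along a line each coordinate is a linear polynomial in \<open>t\<close>, and
  substituting these into a monomial does not raise its degree.\<close>

lemma polynomial_on_line:
  assumes "polynomial_function_deg_le d f"
  shows "\<exists>P. degree P \<le> d \<and> (\<forall>t. f (x + scale t y) = poly P t)"
proof -
  from assms obtain M c where M: "finite M" and deg: "\<And>m. m \<in> M \<Longrightarrow> (\<Sum>b\<in>Basis. m b) \<le> d"
    and f: "\<And>x. f x = (\<Sum>m\<in>M. c m * (\<Prod>b\<in>Basis. coordinate x b ^ m b))"
    unfolding polynomial_function_deg_le_def by blast
  define P where "P = (\<Sum>m\<in>M. smult (c m) (\<Prod>b\<in>Basis. [:coordinate x b, coordinate y b:] ^ m b))"
  have "degree (smult (c m) (\<Prod>b\<in>Basis. [:coordinate x b, coordinate y b:] ^ m b)) \<le> d" if "m \<in> M" for m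
  proof -
    have "degree (\<Prod>b\<in>Basis. [:coordinate x b, coordinate y b:] ^ m b) \<le>
        (\<Sum>b\<in>Basis. degree ([:coordinate x b, coordinate y b:] ^ m b))"
      using degree_prod_sum_le[OF finite_Basis, of "\<lambda>b. [:coordinate x b, coordinate y b:] ^ m b"]
      by (simp add: comp_def)
    also have "\<dots> \<le> (\<Sum>b\<in>Basis. m b)"
    proof (rule sum_mono)
      fix b
      show "degree ([:coordinate x b, coordinate y b:] ^ m b) \<le> m b"
        by (rule order_trans[OF degree_power_le]) simp
    qed
    also have "\<dots> \<le> d"
      using that by (rule deg)
    finally show ?thesis
      using degree_smult_le order_trans by blast
  qed
  then have "degree P \<le> d"
    unfolding P_def by (intro degree_sum_le M)
  moreover have "f (x + scale t y) = poly P t" for t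
    by (simp add: f P_def poly_sum poly_prod coordinate_add coordinate_scale)
  ultimately show ?thesis by blast
qed

lemma determinant_like_mult: "determinant_like D \<Longrightarrow> D (x * y) = D x * D y"
  by (simp add: determinant_like_def)

lemma determinant_like_eq_0_iff: "determinant_like D \<Longrightarrow> D x = 0 \<longleftrightarrow> \<not> is_invertible x"
  by (simp add: determinant_like_def is_invertible_field_iff)

lemma determinant_like_one:
  assumes "determinant_like D"
  shows "D 1 = 1"
proof -
  have "is_invertible (1 :: 'a)"
    unfolding is_invertible_def by (intro exI[of _ 1]) simp
  then have "D 1 \<noteq> 0"
    by (simp add: determinant_like_eq_0_iff[OF assms])
  moreover have "D (1 * 1) = D 1 * D 1"
    by (rule determinant_like_mult[OF assms])
  ultimately show ?thesis by simp
qed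

text \<open>\<open>E\<close> and \<open>1 - E\<close> are orthogonal idempotents, hence
  multiplicativity in \<open>t\<close>. The exponent is positive because at \<open>t = 0\<close> the
  element \<open>1 - E\<close> annihilates \<open>E \<noteq> 0\<close> and so is no unit. The
  exponent acts as a rank of \<open>E\<close>.\<close>

lemma determinant_like_idempotent:
  assumes D: "determinant_like D" and E: "E * E = E" "E \<noteq> 0"
  shows "\<exists>c\<ge>1. \<forall>t. D (1 - E + scale t E) = t ^ c"
proof -
  obtain d where "polynomial_function_deg_le d D"
    using D unfolding determinant_like_def polynomial_function_def by blast
  from polynomial_on_line[OF this] obtain P where P: "\<And>t. D (1 - E + scale t E) = poly P t"
    by blast
  have "(1 - E + scale s E) * (1 - E + scale t E) = 1 - E + scale (s * t) E" for s t
    by (simp add: algebra_simps scale_mult_left scale_mult_right E)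
  then have "poly P (s * t) = poly P s * poly P t" for s t
    by (metis P determinant_like_mult[OF D])
  moreover have "poly P 1 = 1"
    using P[of 1] determinant_like_one[OF D] by simp
  then have "P \<noteq> 0" by auto
  ultimately have monom: "P = monom 1 (degree P)"
    by (intro multiplicative_poly_eq_monom)
  have "\<not> is_invertible (1 - E)"
  proof
    assume "is_invertible (1 - E)"
    then obtain y where "y * (1 - E) = 1"
      unfolding is_invertible_def by blast
    then have "E = y * (1 - E) * E" by simp
    also have "\<dots> = 0"
      by (simp add: algebra_simps E)
    finally show False using E by simp
  qed
  then have "D (1 - E) = 0"
    using determinant_like_eq_0_iff[OF D] by blast
  then have "poly P 0 = 0"
    using P[of 0] by simp
  then have "degree P \<noteq> 0"
    by (subst (asm) monom) (auto simp: poly_monom)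
  moreover have "D (1 - E + scale t E) = t ^ degree P" for t
    unfolding P by (subst monom) (simp add: poly_monom)
  ultimately show ?thesis
    by (intro exI[of _ "degree P"]) auto
qed

text \<open>
  Here \<open>w\<close> restricts to a square root of \<open>- 1\<close> on the image of \<open>E\<close>, so the value at \<open>t = - 1\<close>
  is a square.
\<close>

lemma determinant_like_idempotent_even:
  assumes D: "determinant_like D" and E: "E * E = E" "E \<noteq> 0"
    and w: "w * w = - 1" "E * w = w * E" and no_root: "\<And>\<iota> :: 'k. \<iota> * \<iota> \<noteq> - 1"
  shows "\<exists>c\<ge>2. \<forall>t. D (1 - E + scale t E) = t ^ c"
proof -
  obtain c where c: "c \<ge> 1" "\<And>t. D (1 - E + scale t E) = t ^ c"
    using determinant_like_idempotent[OF D E] by blast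
  have "(w * E) * (w * E) = w * ((E * w) * E)"
    by (simp only: mult.assoc)
  also have "\<dots> = (w * w) * (E * E)"
    by (simp only: w(2) mult.assoc)
  finally have wE: "(w * E) * (w * E) = - E"
    by (simp add: w E)
  have "E * (w * E) = (E * w) * E"
    by (simp only: mult.assoc)
  also have "\<dots> = w * (E * E)"
    by (simp only: w(2) mult.assoc)
  finally have EwE: "E * (w * E) = w * E"
    by (simp add: E)
  have "(1 - E + w * E) * (1 - E + w * E) = 1 - E + scale (- 1) E"
    using wE EwE by (simp add: algebra_simps E)
  then have "D (1 - E + w * E) * D (1 - E + w * E) = (- 1) ^ c"
    using c(2)[of "- 1"] by (simp only: flip: determinant_like_mult[OF D])
  \<comment> \<open>For odd \<open>c\<close> the value \<open>D (1 - E + w * E)\<close> would be a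
    square root of -1 in the field.\<close>
  with no_root have "even c"
    by (metis neg_one_odd_power)
  with c show ?thesis
    by (intro exI[of _ c]) (auto elim: evenE)
qed

text \<open>\<open>F\<close> and \<open>G\<close> cut the image of \<open>E\<close> into the
  eigenspaces of \<open>v\<close> for 1 and -1; they are orthogonal with sum \<open>E\<close>. The
  product formula makes exponents add.\<close>

lemma split_idempotent:
  assumes E: "E * E = E" and v: "v * v = 1" "E * v = v * E"
    and F: "F = scale (1 / 2) (E * (1 + v))" and G: "G = scale (1 / 2) (E * (1 - v))"
  shows "F * F = F" "G * G = G"
    and "(1 - F + scale t F) * (1 - G + scale t G) = 1 - E + scale t E"
proof -
  have Ev: "E * (v * z) = v * (E * z)" "v * (v * z) = z" "E * (E * z) = E * z" for z
    using v E by (simp_all flip: mult.assoc)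
  note simps = algebra_simps scale_mult_left scale_mult_right E v Ev
  have half: "scale (1 / 2) x + scale (1 / 2) x = x" for x
    by (simp flip: scale_left_distrib)
  have double: "scale (1 / 2) X * scale (1 / 2) X = scale (1 / 2) X" if "X * X = X + X" for X
  proof -
    have "scale (1 / 2) X * scale (1 / 2) X = scale (1 / 4) X + scale (1 / 4) X"
      by (simp add: scale_mult_left scale_mult_right that scale_right_distrib)
    also have "\<dots> = scale (1 / 2) X"
      by (simp flip: scale_left_distrib)
    finally show ?thesis .
  qed
  show "F * F = F" "G * G = G"
    unfolding F G by (rule double, simp add: simps)+
  have FG: "F * G = 0"
    unfolding F G by (simp add: simps)
  have sum: "E = F + G"
    unfolding F G by (simp add: simps half)
  show "(1 - F + scale t F) * (1 - G + scale t G) = 1 - E + scale t E"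
    unfolding sum by (simp add: algebra_simps scale_mult_left scale_mult_right FG)
qed

text \<open>The inductive step shared by the next two lemmas. Here \<open>\<tau>\<close> is just a
  scalar-valued linear functional: since \<open>\<tau> (E * v) = 0\<close>, each half has the value
  \<open>\<tau> E / 2\<close> and is nonzero. The premise \<open>IH\<close> lists what a half
  inherits from \<open>E\<close> and \<open>v\<close>, enough to invoke an induction
  hypothesis.\<close>

lemma exponent_by_splitting:
  assumes D: "determinant_like D"
    and \<tau>: "\<And>x y. \<tau> (x + y) = \<tau> x + \<tau> y" "\<And>c x. \<tau> (scale c x) = c * (\<tau> x :: 'k)"
    and E: "E * E = E" "\<tau> E \<noteq> 0" and v: "v * v = 1" "E * v = v * E" "\<tau> (E * v) = 0"
    and IH: "\<And>F. F * F = F \<Longrightarrow> \<tau> F \<noteq> 0 \<Longrightarrow> (\<And>x. E * x = x * E \<Longrightarrow> v * x = x * v \<Longrightarrow> F * x = x * F) \<Longrightarrow>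
      (\<And>p. \<tau> (E * p) = 0 \<Longrightarrow> \<tau> (E * (v * p)) = 0 \<Longrightarrow> \<tau> (F * p) = 0) \<Longrightarrow>
      \<exists>c\<ge>n. \<forall>t. D (1 - F + scale t F) = t ^ c"
  shows "\<exists>c\<ge>2 * n. \<forall>t. D (1 - E + scale t E) = t ^ c"
proof -
  \<comment> \<open>The parameter treats both halves at once; \<open>s = 1\<close> and
    \<open>s = - 1\<close> are the two idempotents.\<close>
  define F where "F s = scale (1 / 2) (E * (1 + scale s v))" for s
  have \<tau>F: "\<tau> (F s * p) = 1 / 2 * (\<tau> (E * p) + s * \<tau> (E * (v * p)))" for s p
    by (simp add: F_def scale_mult_left scale_mult_right distrib_left distrib_right mult.assoc \<tau>)
  have F_commute: "F s * x = x * F s" if "E * x = x * E" "v * x = x * v" for s x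
  proof -
    have "E * (v * x) = x * (E * v)"
      using that by (simp add: mult.assoc) (simp flip: mult.assoc add: that)
    then show ?thesis
      using that by (simp add: F_def scale_mult_left scale_mult_right distrib_left distrib_right mult.assoc)
  qed
  have split: "F 1 = scale (1 / 2) (E * (1 + v))" "F (- 1) = scale (1 / 2) (E * (1 - v))"
    by (simp_all add: F_def)
  have exponent: "\<exists>c\<ge>n. \<forall>t. D (1 - F s + scale t (F s)) = t ^ c" if "F s * F s = F s" for s
  proof (rule IH)
    show "\<tau> (F s) \<noteq> 0"
      using \<tau>F[of s 1] v(3) E(2) by auto
    show "\<tau> (F s * p) = 0" if "\<tau> (E * p) = 0" "\<tau> (E * (v * p)) = 0" for p
      using that by (simp add: \<tau>F)
  qed (use that F_commute in auto)
  note splitE = split_idempotent[OF E(1) v(1,2) split]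
  obtain c where c: "c \<ge> n" "\<And>t. D (1 - F 1 + scale t (F 1)) = t ^ c"
    using exponent[OF splitE(1)] by blast
  obtain c' where c': "c' \<ge> n" "\<And>t. D (1 - F (- 1) + scale t (F (- 1))) = t ^ c'"
    using exponent[OF splitE(2)] by blast
  have "D (1 - E + scale t E) = t ^ (c + c')" for t
    by (metis splitE(3) determinant_like_mult[OF D] c(2) c'(2) power_add)
  then show ?thesis
    using c(1) c'(1) by (intro exI[of _ "c + c'"]) auto
qed

lemma idempotent_exponent_with_root:
  assumes D: "determinant_like D" and no_root: "\<And>\<iota> :: 'k. \<iota> * \<iota> \<noteq> - 1"
    and \<tau>: "\<And>x y. \<tau> (x + y) = \<tau> x + \<tau> y" "\<And>c x. \<tau> (scale c x) = c * (\<tau> x :: 'k)"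
    and w: "w * w = - 1"
    and "E * E = E" "\<tau> E \<noteq> 0" "E * w = w * E"
    and "\<And>u. u \<in> set us \<Longrightarrow> u * u = 1 \<or> u * u = - 1"
    and "\<And>u. u \<in> set us \<Longrightarrow> u * w = w * u"
    and "\<And>u. u \<in> set us \<Longrightarrow> E * u = u * E"
    and "\<And>u u'. u \<in> set us \<Longrightarrow> u' \<in> set us \<Longrightarrow> u * u' = u' * u"
    and "\<And>us'. us' \<in> set (subseqs us) \<Longrightarrow> us' \<noteq> [] \<Longrightarrow> \<tau> (E * prod_list us') = 0"
    and "\<And>us'. us' \<in> set (subseqs us) \<Longrightarrow> us' \<noteq> [] \<Longrightarrow> \<tau> (E * (w * prod_list us')) = 0"
  shows "\<exists>c\<ge>2 ^ Suc (length us). \<forall>t. D (1 - E + scale t E) = t ^ c"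
  using assms(6-)
proof (induction us arbitrary: E)
  case Nil
  have "E \<noteq> 0"
    using Nil \<tau>(2)[of 0 0] by auto
  then show ?case
    using determinant_like_idempotent_even[OF D _ _ w _ no_root] Nil by simp
next
  case (Cons u us)
  have uu: "u * u = 1 \<or> u * u = - 1" and uw: "u * w = w * u" and Eu: "E * u = u * E"
    and us: "\<And>u'. u' \<in> set us \<Longrightarrow> u * u' = u' * u" "\<And>u'. u' \<in> set us \<Longrightarrow> w * u' = u' * w"
      "\<And>u'. u' \<in> set us \<Longrightarrow> E * u' = u' * E"
    using Cons.prems(4,5,6,7) by auto
  define v where "v = (if u * u = 1 then u else w * u)"
  have wuw: "w * (u * (w * p)) = - (u * p)" for p
    using w by (simp add: uw flip: mult.assoc)
  have vv: "v * v = 1"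
    using uu wuw[of u] by (auto simp: v_def mult.assoc)
  have Ev: "E * v = v * E"
    using Eu Cons.prems(3) by (simp add: v_def flip: mult.assoc) (simp add: mult.assoc)
  have vw: "v * w = w * v"
    using uw by (simp add: v_def mult.assoc)
  have vus: "v * u' = u' * v" if "u' \<in> set us" for u'
    using us(1)[OF that] by (simp add: v_def mult.assoc) (simp add: us(2)[OF that] flip: mult.assoc)
  \<comment> \<open>A second \<open>w\<close> can only come from \<open>v = w * u\<close>;
    \<open>w * w = - 1\<close> turns the pair into a sign, so the hypotheses for
    \<open>u # us'\<close> suffice.\<close>
  have zero: "\<tau> (E * p) = 0" "\<tau> (E * (w * p)) = 0" "\<tau> (E * (v * p)) = 0" "\<tau> (E * (v * (w * p))) = 0"
    if "us' \<in> set (subseqs us)" "us' \<noteq> []" "p = prod_list us'" for p us'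
  proof -
    have sub: "u # us' \<in> set (subseqs (u # us))" "us' \<in> set (subseqs (u # us))"
      using that by (simp_all add: Let_def)
    show E: "\<tau> (E * p) = 0" "\<tau> (E * (w * p)) = 0"
      using Cons.prems(8,9)[OF sub(2)] that by simp_all
    have "\<tau> (E * (u * p)) = 0" "\<tau> (E * (w * (u * p))) = 0"
      using Cons.prems(8,9)[OF sub(1)] that by simp_all
    moreover have "u * (w * p) = w * (u * p)"
      using uw by (simp flip: mult.assoc)
    moreover have "w * (w * (u * p)) = - (u * p)"
      using w by (simp flip: mult.assoc)
    moreover have "\<tau> (- x) = - \<tau> x" for x
      using \<tau>(2)[of "- 1" x] by simp
    ultimately show "\<tau> (E * (v * p)) = 0" "\<tau> (E * (v * (w * p))) = 0"
      by (simp_all add: v_def wuw mult.assoc)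
  qed
  have "[u] \<in> set (subseqs (u # us))"
    using subset_subseqs[of "{}" us] by (auto simp: Let_def)
  then have \<tau>Ev: "\<tau> (E * v) = 0"
    using Cons.prems(8,9)[of "[u]"] by (simp add: v_def)
  have "\<exists>c\<ge>2 * 2 ^ Suc (length us). \<forall>t. D (1 - E + scale t E) = t ^ c"
  proof (rule exponent_by_splitting[OF D \<tau> Cons.prems(1,2) vv Ev \<tau>Ev], rule Cons.IH)
    show "u1 * u2 = u2 * u1" if "u1 \<in> set us" "u2 \<in> set us" for u1 u2
      using that Cons.prems(7) by simp
  qed (use Cons.prems(3,4,5) us vus vw zero in auto)
  then show ?case
    by simp
qed

text \<open>Every blade contributes a factor 2: by splitting if a scalar multiple of it squares to
  1, otherwise by the evenness that it forces.\<close>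

lemma idempotent_exponent:
  assumes D: "determinant_like D"
    and \<tau>: "\<And>x y. \<tau> (x + y) = \<tau> x + \<tau> y" "\<And>c x. \<tau> (scale c x) = c * (\<tau> x :: 'k)"
    and "E * E = E" "\<tau> E \<noteq> 0"
    and "\<And>u. u \<in> set us \<Longrightarrow> u * u = 1 \<or> u * u = - 1"
    and "\<And>u. u \<in> set us \<Longrightarrow> E * u = u * E"
    and "\<And>u u'. u \<in> set us \<Longrightarrow> u' \<in> set us \<Longrightarrow> u * u' = u' * u"
    and "\<And>us'. us' \<in> set (subseqs us) \<Longrightarrow> us' \<noteq> [] \<Longrightarrow> \<tau> (E * prod_list us') = 0"
  shows "\<exists>c\<ge>2 ^ length us. \<forall>t. D (1 - E + scale t E) = t ^ c"
  using assms(4-)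
proof (induction us arbitrary: E)
  case Nil
  have "E \<noteq> 0"
    using Nil \<tau>(2)[of 0 0] by auto
  then show ?case
    using determinant_like_idempotent[OF D] Nil by simp
next
  case (Cons u us)
  have uu: "u * u = 1 \<or> u * u = - 1" and Eu: "E * u = u * E"
    using Cons.prems(3,4) by auto
  have zero: "\<tau> (E * prod_list us') = 0" if "us' \<in> set (subseqs us)" "us' \<noteq> []" for us'
    using that Cons.prems(6)[of us'] by (auto simp: Let_def)
  have zero': "\<tau> (E * (u * prod_list us')) = 0" if "us' \<in> set (subseqs us)" for us'
    using that Cons.prems(6)[of "u # us'"] by (auto simp: Let_def)
  show ?case
  proof (cases "u * u = 1 \<or> (\<exists>\<iota> :: 'k. \<iota> * \<iota> = - 1)")
    case True
    \<comment> \<open>The factor is 1 if \<open>u * u = 1\<close>, and otherwise a square root of -1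
      in the field.\<close>
    then obtain \<kappa> :: 'k where vv: "scale \<kappa> u * scale \<kappa> u = 1"
    proof (cases "u * u = 1")
      case one: True
      then show ?thesis by (intro that[of 1]) simp
    next
      case False
      with True uu obtain \<iota> :: 'k where "\<iota> * \<iota> = - 1" "u * u = - 1"
        by blast
      then show ?thesis
        by (intro that[of \<iota>]) (simp add: scale_mult_left scale_mult_right)
    qed
    have "\<exists>c\<ge>2 * 2 ^ length us. \<forall>t. D (1 - E + scale t E) = t ^ c"
    proof (rule exponent_by_splitting[OF D \<tau> Cons.prems(1,2) vv], goal_cases)
      case 1
      show ?case using Eu by (simp add: scale_mult_left scale_mult_right)
    next
      case 2
      have "[] \<in> set (subseqs us)"
        using subset_subseqs[of "{}" us] by auto
      then show ?case using zero'[of "[]"] by (simp add: scale_mult_right \<tau>)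
    next
      case (3 F)
      show ?case
      proof (rule Cons.IH)
        show "\<tau> (F * prod_list us') = 0" if "us' \<in> set (subseqs us)" "us' \<noteq> []" for us'
          using 3(4) zero[OF that] zero'[OF that(1)] by (simp add: scale_mult_left scale_mult_right \<tau>)
      qed (use 3(1,2) in \<open>auto intro!: 3(3) simp: scale_mult_left scale_mult_right Cons.prems\<close>)
    qed
    then show ?thesis by simp
  next
    case False
    \<comment> \<open>Now \<open>u * u = - 1\<close> and the field has no such root, so
      \<open>u\<close> becomes the permanent \<open>w\<close> for the rest of the list.\<close>
    have "\<exists>c\<ge>2 ^ Suc (length us). \<forall>t. D (1 - E + scale t E) = t ^ c"
      using False uu by (intro idempotent_exponent_with_root[OF D _ \<tau>, of u])
        (auto simp: zero zero' Cons.prems)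
    then show ?thesis by simp
  qed
qed

text \<open>The case \<open>E = 1\<close>: on the scalar line \<open>D\<close> is
  \<open>t ^ c\<close> with \<open>c\<close> large, and restriction to a line cannot raise the
  degree.\<close>

theorem determinant_like_degree_ge:
  assumes D: "determinant_like D"
    and \<tau>: "\<And>x y. \<tau> (x + y) = \<tau> x + \<tau> y" "\<And>c x. \<tau> (scale c x) = c * (\<tau> x :: 'k)" "\<tau> 1 \<noteq> 0"
    and us: "\<And>u. u \<in> set us \<Longrightarrow> u * u = 1 \<or> u * u = - 1"
      "\<And>u u'. u \<in> set us \<Longrightarrow> u' \<in> set us \<Longrightarrow> u * u' = u' * u"
      "\<And>us'. us' \<in> set (subseqs us) \<Longrightarrow> us' \<noteq> [] \<Longrightarrow> \<tau> (prod_list us') = 0"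
  shows "2 ^ length us \<le> polynomial_function_degree D"
proof -
  have "\<exists>c\<ge>2 ^ length us. \<forall>t. D (1 - 1 + scale t 1) = t ^ c"
    by (rule idempotent_exponent[OF D \<tau>(1,2)]) (use \<tau>(3) us in auto)
  then obtain c where c: "c \<ge> 2 ^ length us" "\<And>t. D (0 + scale t 1) = t ^ c"
    by auto
  have "polynomial_function D"
    using D by (simp add: determinant_like_def)
  from polynomial_on_line[OF polynomial_function_deg_le_degree[OF this]]
  obtain P where P: "degree P \<le> polynomial_function_degree D" "\<And>t. D (0 + scale t 1) = poly P t"
    by blast
  have "P = monom 1 c"
    by (intro poly_eq_poly_eq_iff[THEN iffD1] ext) (metis P(2) c(2) poly_monom mult_1)
  with P(1) c(1) show ?thesis
    by (simp add: degree_monom_eq)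
qed

end

section \<open>Products of blades\<close>

context clifford_algebra
begin

definition indices :: "nat set" where
  "indices = {1..p + q}"

lemma finite_indices: "finite indices"
  by (simp add: indices_def)

lemma finite_subset_indices: "S \<subseteq> indices \<Longrightarrow> finite S"
  by (rule finite_subset[OF _ finite_indices])

definition blade_coeff :: "'a \<Rightarrow> nat set \<Rightarrow> 'k" where
  "blade_coeff x S = coordinate x (blade e S)"

lemma blade_coeff_add: "blade_coeff (x + y) S = blade_coeff x S + blade_coeff y S"
  unfolding blade_coeff_def by (rule coordinate_add)

lemma blade_coeff_scale: "blade_coeff (scale c x) S = c * blade_coeff x S"
  unfolding blade_coeff_def by (rule coordinate_scale)

lemma blade_coeff_minus: "blade_coeff (- x) S = - blade_coeff x S"
  using blade_coeff_scale[of "- 1" x] by simp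

lemma blade_coeff_diff: "blade_coeff (x - y) S = blade_coeff x S - blade_coeff y S"
  using blade_coeff_add[of x "- y"] by (simp add: blade_coeff_minus)

lemma blade_coeff_zero: "blade_coeff 0 S = 0"
  using blade_coeff_scale[of 0 0] by simp

lemma blade_coeff_blade:
  assumes "S \<subseteq> indices" "T \<subseteq> indices"
  shows "blade_coeff (blade e S) T = (if S = T then 1 else 0)"
proof -
  have "blade e S \<in> blade e ` Pow {1..p + q}"
    using assms(1) unfolding indices_def by blast
  from representation_basis[OF independent_Basis this]
  have "blade_coeff (blade e S) T = (if blade e T = blade e S then 1 else 0)"
    unfolding blade_coeff_def by simp
  moreover have "blade e T = blade e S \<longleftrightarrow> T = S"
    using inj_on_eq_iff[OF inj_blade, of T S] assms unfolding indices_def by blast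
  ultimately show ?thesis by auto
qed

lemma blade_expansion: "(\<Sum>S\<in>Pow indices. scale (blade_coeff x S) (blade e S)) = x"
  using coordinate_expansion[of x]
  unfolding sum.reindex[OF inj_blade] comp_def blade_coeff_def indices_def .

lemma blade_induct:
  assumes "\<And>S. S \<subseteq> indices \<Longrightarrow> P (blade e S)"
    and "\<And>x y. P x \<Longrightarrow> P y \<Longrightarrow> P (x + y)" and "\<And>c x. P x \<Longrightarrow> P (scale c x)"
  shows "P x"
proof -
  have "P (blade e {})" by (rule assms(1)) simp
  from assms(3)[OF this, of 0] have "P 0" by simp
  have "P (\<Sum>S\<in>A. scale (blade_coeff x S) (blade e S))" if "finite A" "A \<subseteq> Pow indices" for A
    using that by (induction A rule: finite_induct) (simp_all add: assms \<open>P 0\<close>)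
  from this[of "Pow indices"] show ?thesis
    by (simp add: blade_expansion finite_indices)
qed

lemma blade_eqI:
  assumes "\<And>S. S \<subseteq> indices \<Longrightarrow> blade_coeff x S = blade_coeff y S"
  shows "x = y"
  by (subst blade_expansion[of x, symmetric], subst blade_expansion[of y, symmetric])
    (simp add: assms)

lemma blade_empty: "blade e {} = 1"
  by (simp add: blade_def)

lemma reversed_blade_empty: "reversed_blade e {} = 1"
  by (simp add: reversed_blade_def)

lemma extend_linearly_eq: "extend_linearly g x = (\<Sum>S\<in>Pow indices. scale (blade_coeff x S) (g S))"
  unfolding extend_linearly_def blade_coeff_def indices_def ..

lemma extend_linearly_add: "extend_linearly g (x + y) = extend_linearly g x + extend_linearly g y"
  by (simp add: extend_linearly_eq blade_coeff_add scale_left_distrib sum.distrib)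

lemma extend_linearly_scale: "extend_linearly g (scale c x) = scale c (extend_linearly g x)"
  by (simp add: extend_linearly_eq blade_coeff_scale scale_sum_right)

lemma extend_linearly_blade:
  assumes "S \<subseteq> indices"
  shows "extend_linearly g (blade e S) = g S"
proof -
  have "extend_linearly g (blade e S) = (\<Sum>T\<in>Pow indices. if S = T then g T else 0)"
    unfolding extend_linearly_eq
    by (rule sum.cong) (simp_all add: blade_coeff_blade[OF assms])
  then show ?thesis
    using assms by (simp add: finite_indices)
qed

text \<open>All signs are scalars \<open>(- 1) ^ k\<close>, so that they move freely through products.\<close>

abbreviation sign :: "nat \<Rightarrow> 'a \<Rightarrow> 'a" where
  "sign k \<equiv> scale ((- 1) ^ k)"

lemma minus_one_power_mult: "(- 1) ^ k * x = sign k x"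
  by (cases "even k") (simp_all add: neg_one_odd_power)

lemma sign_sign: "sign k (sign k x) = x"
  by (simp flip: power_mult_distrib)

section \<open>Sign rules for words in the generators and for blades\<close>

lemma generator_square:
  assumes "i \<in> indices"
  shows "\<exists>k. e i * e i = sign k 1"
proof (cases "i \<le> p")
  case True
  then show ?thesis
    using square_negative[of i] assms by (intro exI[of _ 1]) (simp add: indices_def)
next
  case False
  then show ?thesis
    using square_positive[of i] assms by (intro exI[of _ 0]) (simp add: indices_def)
qed

lemma generator_commute:
  assumes "i \<in> indices" "j \<in> indices" "i \<noteq> j"
  shows "e i * e j = - (e j * e i)"
  using anticommute[of i j] assms by (simp add: eq_neg_iff_add_eq_0 indices_def)

abbreviation word :: "nat list \<Rightarrow> 'a" where
  "word xs \<equiv> prod_list (map e xs)"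

lemma word_eq_blade: "sorted xs \<Longrightarrow> distinct xs \<Longrightarrow> word xs = blade e (set xs)"
  by (simp add: blade_def sorted_list_of_set.idem_if_sorted_distinct)

lemma reversed_word_eq_blade:
  "sorted xs \<Longrightarrow> distinct xs \<Longrightarrow> word (rev xs) = reversed_blade e (set xs)"
  by (simp add: reversed_blade_def sorted_list_of_set.idem_if_sorted_distinct)

text \<open>\<open>e i\<close> moves right past the smaller generators with one sign each, then is
  inserted or cancels against an equal generator. The reversed word undergoes the mirrored moves, so
  one \<open>k\<close> serves both; this common sign is what makes the conjugations reverse
  products.\<close>

lemma generator_mult_word:
  assumes "i \<in> indices" "set xs \<subseteq> indices" "sorted xs" "distinct xs"
  shows "\<exists>k zs. sorted zs \<and> distinct zs \<and> set zs = sym_diff {i} (set xs) \<and>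
    e i * word xs = sign k (word zs) \<and> word (rev xs) * e i = sign k (word (rev zs))"
  using assms(2-)
proof (induction xs)
  case Nil
  show ?case
    by (intro exI[of _ 0] exI[of _ "[i]"]) simp
next
  case (Cons x xs)
  consider "i < x" | "i = x" | "x < i" by linarith
  then show ?case
  proof cases
    case 1
    with Cons.prems show ?thesis
      by (intro exI[of _ 0] exI[of _ "i # x # xs"]) (auto simp: mult.assoc)
  next
    case 2
    from generator_square[OF assms(1)] obtain k where "e i * e i = sign k 1" ..
    then have "e i * (e i * z) = sign k z" "z * e i * e i = sign k z" for z
      by (simp_all add: mult.assoc scale_mult_right)
        (simp flip: mult.assoc add: scale_mult_left)
    with 2 Cons.prems show ?thesis
      by (intro exI[of _ k] exI[of _ xs]) auto
  next
    case 3
    from Cons obtain k zs where zs: "sorted zs" "distinct zs" "set zs = sym_diff {i} (set xs)"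
      and eq: "e i * word xs = sign k (word zs)" "word (rev xs) * e i = sign k (word (rev zs))"
      by auto
    have comm: "e i * e x = - (e x * e i)" "e x * e i = - (e i * e x)"
      using 3 Cons.prems assms(1) generator_commute[of i x] by auto
    have "e i * word (x # xs) = - (e x * (e i * word xs))"
      by (simp add: comm(1) flip: mult.assoc)
    also have "\<dots> = sign (Suc k) (word (x # zs))"
      by (simp add: eq scale_mult_right)
    finally have 1: "e i * word (x # xs) = sign (Suc k) (word (x # zs))" .
    have "word (rev (x # xs)) * e i = - ((word (rev xs) * e i) * e x)"
      by (simp add: comm(2) mult.assoc)
    also have "\<dots> = sign (Suc k) (word (rev (x # zs)))"
      by (simp add: eq scale_mult_left)
    finally have "word (rev (x # xs)) * e i = sign (Suc k) (word (rev (x # zs)))" .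
    with 1 zs 3 Cons.prems show ?thesis
      by (intro exI[of _ "Suc k"] exI[of _ "x # zs"]) auto
  qed
qed

lemma generator_mult_blade:
  assumes "i \<in> indices" "S \<subseteq> indices"
  shows "\<exists>k. e i * blade e S = sign k (blade e (sym_diff {i} S)) \<and>
    reversed_blade e S * e i = sign k (reversed_blade e (sym_diff {i} S))"
proof -
  have fin: "finite S"
    using assms(2) by (rule finite_subset_indices)
  obtain k zs where zs: "sorted zs" "distinct zs" "set zs = sym_diff {i} S"
    "e i * word (sorted_list_of_set S) = sign k (word zs)"
    "word (rev (sorted_list_of_set S)) * e i = sign k (word (rev zs))"
    using generator_mult_word[OF assms(1), of "sorted_list_of_set S"] assms(2) fin
    by (metis sorted_list_of_set.set_sorted_key_list_of_set sorted_list_of_set.sorted_sorted_key_list_of_set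
        sorted_list_of_set.distinct_sorted_key_list_of_set)
  have "e i * blade e S = sign k (blade e (sym_diff {i} S))"
    using zs(4) unfolding word_eq_blade[OF zs(1,2)] zs(3) blade_def[of e S] .
  moreover have "reversed_blade e S * e i = sign k (reversed_blade e (sym_diff {i} S))"
    using zs(5) unfolding reversed_word_eq_blade[OF zs(1,2)] zs(3) reversed_blade_def[of e S] .
  ultimately show ?thesis by blast
qed

text \<open>Only the resulting index set matters here; where signs count,
  \<open>blade_commute\<close> compares the two orders.\<close>

lemma blade_mult_blade:
  assumes "S \<subseteq> indices" "T \<subseteq> indices"
  shows "\<exists>k. blade e S * blade e T = sign k (blade e (sym_diff S T))"
proof -
  have "\<exists>k. word xs * blade e T = sign k (blade e (sym_diff (set xs) T))"
    if "set xs \<subseteq> indices" "distinct xs" for xs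
    using that
  proof (induction xs)
    case Nil
    show ?case by (intro exI[of _ 0]) simp
  next
    case (Cons x xs)
    then obtain k where k: "word xs * blade e T = sign k (blade e (sym_diff (set xs) T))"
      by auto
    have "x \<in> indices" "sym_diff (set xs) T \<subseteq> indices"
      using Cons.prems assms(2) by auto
    from generator_mult_blade[OF this] obtain k' where
      "e x * blade e (sym_diff (set xs) T) = sign k' (blade e (sym_diff {x} (sym_diff (set xs) T)))"
      by blast
    moreover have "sym_diff {x} (sym_diff (set xs) T) = sym_diff (set (x # xs)) T"
      using Cons.prems by auto
    ultimately show ?case
      by (intro exI[of _ "k + k'"]) (simp add: k mult.assoc scale_mult_right power_add)
  qed
  from this[of "sorted_list_of_set S"] have "\<exists>k. word (sorted_list_of_set S) * blade e T = sign k (blade e (sym_diff S T))"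
    using assms(1) finite_subset_indices[OF assms(1)] by simp
  then show ?thesis
    unfolding blade_def[of e S] .
qed

text \<open>\<open>e i\<close> passes itself without a sign. Adding the cardinality has the same
  parity as subtracting it and avoids subtraction of naturals.\<close>

lemma generator_word_commute:
  assumes "i \<in> indices" "set xs \<subseteq> indices" "distinct xs"
  shows "e i * word xs = sign (length xs + card ({i} \<inter> set xs)) (word xs * e i)"
  using assms(2-)
proof (induction xs)
  case Nil
  show ?case by simp
next
  case (Cons x xs)
  have IH: "e i * word xs = sign (length xs + card ({i} \<inter> set xs)) (word xs * e i)"
    using Cons by simp
  show ?case
  proof (cases "i = x")
    case True
    then have "{i} \<inter> set xs = {}" "{i} \<inter> set (x # xs) = {i}"
      using Cons.prems by auto
    then have IH': "e x * word xs = sign (length xs) (word xs * e x)"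
      using IH True by simp
    have "e i * word (x # xs) = e x * (e x * word xs)"
      using True by simp
    also have "\<dots> = e x * sign (length xs) (word xs * e x)"
      by (simp only: IH')
    also have "\<dots> = sign (length (x # xs) + card ({i} \<inter> set (x # xs))) (word (x # xs) * e i)"
      by (simp add: scale_mult_right mult.assoc True)
    finally show ?thesis .
  next
    case False
    then have "e i * word (x # xs) = - (e x * (e i * word xs))"
      using generator_commute[of i x] Cons.prems assms(1) by (simp flip: mult.assoc)
    moreover have "{i} \<inter> set (x # xs) = {i} \<inter> set xs"
      using False by auto
    ultimately show ?thesis
      by (simp only: IH) (simp add: scale_mult_right mult.assoc)
  qed
qed

text \<open>One sign for each pair from \<open>S\<close> and \<open>T\<close>, except for the pairs
  of equal generators.\<close>

lemma blade_commute:
  assumes "S \<subseteq> indices" "T \<subseteq> indices"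
  shows "blade e S * blade e T = sign (card S * card T + card (S \<inter> T)) (blade e T * blade e S)"
proof -
  have fin: "finite S" "finite T"
    using assms finite_subset_indices by blast+
  have "word xs * blade e T =
      sign (length xs * card T + card (set xs \<inter> T)) (blade e T * word xs)"
    if "set xs \<subseteq> indices" "distinct xs" for xs
    using that
  proof (induction xs)
    case Nil
    show ?case by simp
  next
    case (Cons x xs)
    have gen: "e x * blade e T = sign (card T + card ({x} \<inter> T)) (blade e T * e x)"
      using generator_word_commute[of x "sorted_list_of_set T"] Cons.prems assms(2) fin
      by (simp add: blade_def)
    have card: "card (set (x # xs) \<inter> T) = card ({x} \<inter> T) + card (set xs \<inter> T)"
      using Cons.prems by (auto simp: Int_insert_left)
    let ?k = "length xs * card T + card (set xs \<inter> T)"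
    have "word (x # xs) * blade e T = e x * (word xs * blade e T)"
      by (simp add: mult.assoc)
    also have "\<dots> = sign ?k ((e x * blade e T) * word xs)"
      using Cons by (simp add: scale_mult_right mult.assoc)
    also have "\<dots> = sign (?k + (card T + card ({x} \<inter> T))) (blade e T * word (x # xs))"
      unfolding gen by (simp add: scale_mult_left power_add mult.assoc)
    also have "?k + (card T + card ({x} \<inter> T)) = length (x # xs) * card T + card (set (x # xs) \<inter> T)"
      unfolding card by simp
    finally show ?case .
  qed
  from this[of "sorted_list_of_set S"] show ?thesis
    using assms(1) fin by (simp add: blade_def[of e S])
qed

text \<open>Reversal exchanges every pair of distinct generators exactly once.\<close>

lemma reversed_blade_eq:
  assumes "S \<subseteq> indices"
  shows "reversed_blade e S = sign (card S choose 2) (blade e S)"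
proof -
  have "word (rev xs) = sign (length xs choose 2) (word xs)"
    if "set xs \<subseteq> indices" "distinct xs" for xs
    using that
  proof (induction xs)
    case Nil
    show ?case by (simp add: numeral_2_eq_2)
  next
    case (Cons x xs)
    have "e x * word xs = sign (length xs) (word xs * e x)"
      using generator_word_commute[of x xs] Cons.prems by simp
    then have "word xs * e x = sign (length xs) (e x * word xs)"
      by (simp only: sign_sign)
    then show ?case
      using Cons by (simp add: scale_mult_left numeral_2_eq_2 power_add mult_ac)
  qed
  from this[of "sorted_list_of_set S"] show ?thesis
    using assms finite_subset_indices[OF assms] by (simp add: blade_def reversed_blade_def)
qed

end

section \<open>Conjugations and the center\<close>

context clifford_algebra
begin

text \<open>Reversion is the case \<open>s = 0\<close>, Clifford conjugation the case \<open>s = 1\<close>.\<close>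

definition conjugation :: "nat \<Rightarrow> 'a \<Rightarrow> 'a" where
  "conjugation s = extend_linearly (\<lambda>S. sign (s * card S) (reversed_blade e S))"

lemma clifford_conj_eq: "clifford_conj = conjugation 1"
  by (simp add: clifford_conj_def conjugation_def minus_one_power_mult)

lemma reversion_eq: "reversion = conjugation 0"
  by (simp add: reversion_def conjugation_def)

lemma conjugation_add: "conjugation s (x + y) = conjugation s x + conjugation s y"
  by (simp add: conjugation_def extend_linearly_add)

lemma conjugation_scale: "conjugation s (scale c x) = scale c (conjugation s x)"
  by (simp add: conjugation_def extend_linearly_scale)

lemma conjugation_blade:
  "S \<subseteq> indices \<Longrightarrow> conjugation s (blade e S) = sign (s * card S) (reversed_blade e S)"
  by (simp add: conjugation_def extend_linearly_blade)

lemma conjugation_one: "conjugation s 1 = 1"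
  using conjugation_blade[of "{}" s] by (simp add: blade_empty reversed_blade_empty)

text \<open>Conjugations are diagonal on blades with entries 1 and -1. Involutivity, commutation and
  the shape of fixed elements can be read off from this.\<close>

lemma blade_coeff_conjugation:
  assumes "S \<subseteq> indices"
  shows "blade_coeff (conjugation s x) S = (- 1) ^ (s * card S + (card S choose 2)) * blade_coeff x S"
proof (induction x rule: blade_induct)
  case (1 T)
  then show ?case
    using assms by (simp add: conjugation_blade reversed_blade_eq blade_coeff_scale blade_coeff_blade power_add)
qed (simp_all add: conjugation_add conjugation_scale blade_coeff_add blade_coeff_scale algebra_simps)

lemma conjugation_conjugation: "conjugation s (conjugation s x) = x"
  by (rule blade_eqI) (simp add: blade_coeff_conjugation flip: mult.assoc power_mult_distrib)

lemma conjugation_commute: "conjugation s (conjugation s' x) = conjugation s' (conjugation s x)"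
  by (rule blade_eqI) (simp add: blade_coeff_conjugation)

text \<open>Multiplying by \<open>e i\<close> changes the size of a blade by one, which yields
  \<open>sign s\<close>; the reordering sign agrees on both sides by
  \<open>generator_mult_blade\<close>.\<close>

lemma conjugation_generator_mult:
  assumes "i \<in> indices"
  shows "conjugation s (e i * x) = conjugation s x * sign s (e i)"
proof (induction x rule: blade_induct)
  case (1 S)
  obtain k where k: "e i * blade e S = sign k (blade e (sym_diff {i} S))"
    "reversed_blade e S * e i = sign k (reversed_blade e (sym_diff {i} S))"
    using generator_mult_blade[OF assms 1] by blast
  have sub: "sym_diff {i} S \<subseteq> indices"
    using assms 1 by auto
  have "even (card (sym_diff {i} S)) \<longleftrightarrow> odd (card S)"
  proof (cases "i \<in> S")
    case True
    then have "sym_diff {i} S = S - {i}" by auto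
    then show ?thesis
      using True finite_subset_indices[OF 1] card_gt_0_iff[of S] by (auto simp: card_Diff_singleton)
  next
    case False
    then have "sym_diff {i} S = insert i S" by auto
    then show ?thesis
      using False finite_subset_indices[OF 1] by simp
  qed
  then have "(- 1 :: 'k) ^ (s * card (sym_diff {i} S)) = (- 1) ^ (s * card S + s)"
    by (auto simp: minus_one_power_iff)
  then have "conjugation s (e i * blade e S) = sign (s * card S + s) (reversed_blade e S * e i)"
    by (simp only: k conjugation_scale conjugation_blade[OF sub]) (simp add: mult.commute)
  then show ?case
    by (simp add: conjugation_blade[OF 1] scale_mult_left scale_mult_right power_add mult.commute)
next
  case (2 x y)
  then show ?case
    by (simp add: distrib_left distrib_right conjugation_add)
next
  case (3 c x)
  then show ?case
    by (simp add: scale_mult_right scale_mult_left conjugation_scale scale_left_commute)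
qed

lemma conjugation_mult: "conjugation s (x * y) = conjugation s y * conjugation s x"
proof (induction x rule: blade_induct)
  case (1 S)
  have "conjugation s (word xs * y) = conjugation s y * sign (s * length xs) (word (rev xs))"
    if "set xs \<subseteq> indices" for xs
    using that
  proof (induction xs)
    case Nil
    show ?case by simp
  next
    case (Cons x xs)
    then show ?case
      by (simp add: mult.assoc conjugation_generator_mult scale_mult_left scale_mult_right power_add)
  qed
  from this[of "sorted_list_of_set S"] show ?case
    using 1 finite_subset_indices[OF 1]
    by (simp only: conjugation_blade[OF 1]) (simp add: blade_def reversed_blade_def)
qed (simp_all add: distrib_left distrib_right conjugation_add conjugation_scale scale_mult_left scale_mult_right)

text \<open>The index sets of the blades in the center.\<close>

definition central_index :: "nat set \<Rightarrow> bool" where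
  "central_index S \<longleftrightarrow> S = {} \<or> S = indices \<and> odd (p + q)"

text \<open>The projection along the noncentral blades. Being central is expressed throughout by
  \<open>central_part z = z\<close>.\<close>

definition central_part :: "'a \<Rightarrow> 'a" where
  "central_part = extend_linearly (\<lambda>S. if central_index S then blade e S else 0)"

lemma card_indices: "card indices = p + q"
  by (simp add: indices_def)

lemma central_part_add: "central_part (x + y) = central_part x + central_part y"
  by (simp add: central_part_def extend_linearly_add)

lemma central_part_scale: "central_part (scale c x) = scale c (central_part x)"
  by (simp add: central_part_def extend_linearly_scale)

lemma central_part_blade:
  "S \<subseteq> indices \<Longrightarrow> central_part (blade e S) = (if central_index S then blade e S else 0)"
  by (simp add: central_part_def extend_linearly_blade)

lemma central_part_one: "central_part 1 = 1"
  using central_part_blade[of "{}"] by (simp add: central_index_def blade_empty)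

lemma central_part_zero: "central_part 0 = 0"
  using central_part_scale[of 0 0] by simp

lemma blade_coeff_central_part:
  assumes "S \<subseteq> indices"
  shows "blade_coeff (central_part x) S = (if central_index S then blade_coeff x S else 0)"
proof (induction x rule: blade_induct)
  case (1 T)
  then show ?case
    using assms by (auto simp: central_part_blade blade_coeff_blade blade_coeff_zero)
qed (simp_all add: central_part_add central_part_scale blade_coeff_add blade_coeff_scale)

lemma central_part_eq_iff:
  "central_part x = x \<longleftrightarrow> (\<forall>S\<subseteq>indices. blade_coeff x S \<noteq> 0 \<longrightarrow> central_index S)"
proof
  assume "central_part x = x"
  then show "\<forall>S\<subseteq>indices. blade_coeff x S \<noteq> 0 \<longrightarrow> central_index S"
    using blade_coeff_central_part[of _ x] by metis
next
  assume "\<forall>S\<subseteq>indices. blade_coeff x S \<noteq> 0 \<longrightarrow> central_index S"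
  then show "central_part x = x"
    by (intro blade_eqI) (auto simp: blade_coeff_central_part)
qed

lemma central_part_central_part: "central_part (central_part x) = central_part x"
  by (rule blade_eqI) (simp add: blade_coeff_central_part)

text \<open>For odd \<open>p + q\<close> the exponent \<open>(p + q) * card T + card T\<close> is
  even, so the pseudoscalar commutes with every blade.\<close>

lemma central_part_commute: "central_part x * y = y * central_part x"
proof (induction x rule: blade_induct)
  case (1 S)
  show ?case
  proof (cases "S = indices \<and> odd (p + q)")
    case True
    have "blade e indices * y = y * blade e indices"
    proof (induction y rule: blade_induct)
      case (1 T)
      then have "card (indices \<inter> T) = card T"
        by (simp add: Int_absorb1)
      then show ?case
        using blade_commute[of indices T] 1 True by (simp add: card_indices)
    qed (simp_all add: distrib_left distrib_right scale_mult_left scale_mult_right)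
    then show ?thesis
      using True 1 by (simp add: central_part_blade central_index_def)
  next
    case False
    then show ?thesis
      using 1 by (auto simp: central_part_blade central_index_def blade_empty)
  qed
qed (simp_all add: central_part_add central_part_scale distrib_left distrib_right scale_mult_left scale_mult_right)

lemma central_part_blade_mult:
  assumes "S \<subseteq> indices" "T \<subseteq> indices"
  shows "central_part (blade e S * blade e T) =
    (if central_index (sym_diff S T) then blade e S * blade e T else 0)"
proof -
  have "sym_diff S T \<subseteq> indices"
    using assms by auto
  then show ?thesis
    using blade_mult_blade[OF assms] by (auto simp: central_part_scale central_part_blade)
qed

text \<open>A product of two blades has a central part only if they are equal, or complementary with
  \<open>p + q\<close> odd. In the second case one of the sizes is even and the blades are disjoint,
  so they commute.\<close>

lemma central_part_mult_commute: "central_part (x * y) = central_part (y * x)"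
proof (induction x rule: blade_induct)
  case S: (1 S)
  show ?case
  proof (induction y rule: blade_induct)
    case T: (1 T)
    have "blade e S * blade e T = blade e T * blade e S" if central: "central_index (sym_diff S T)"
    proof (cases "S = T")
      case False
      then have "sym_diff S T \<noteq> {}" by auto
      then have compl: "sym_diff S T = indices" "odd (p + q)"
        using central by (auto simp: central_index_def)
      then have "T = indices - S" "S \<inter> T = {}"
        using S T by auto
      then have "card S + card T = p + q"
        using S T card_Un_disjoint[of S T] finite_subset_indices card_indices
        by (metis Un_Diff_cancel sup.absorb2)
      then have "even (card S * card T)"
        using compl(2) by (metis even_add even_mult_iff)
      then show ?thesis
        using blade_commute[OF S T] \<open>S \<inter> T = {}\<close> by simp
    qed simp
    then show ?case
      using central_part_blade_mult[OF S T] central_part_blade_mult[OF T S] by (simp add: Un_commute)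
  qed (simp_all add: distrib_left distrib_right central_part_add central_part_scale scale_mult_left scale_mult_right)
qed (simp_all add: distrib_left distrib_right central_part_add central_part_scale scale_mult_left scale_mult_right)

text \<open>The central index sets form a group under symmetric difference, so multiplying by a
  central blade preserves centrality and noncentrality of blades.\<close>

lemma central_part_linear: "central_part (central_part x * y) = central_part x * central_part y"
proof (induction x rule: blade_induct)
  case S: (1 S)
  show ?case
  proof (induction y rule: blade_induct)
    case T: (1 T)
    have "central_index (sym_diff S T) \<longleftrightarrow> central_index T" if "central_index S"
      using that S T by (auto simp: central_index_def)
    then show ?case
      using central_part_blade_mult[OF S T]
      by (simp add: central_part_blade S T central_part_zero)
  qed (simp_all add: distrib_left central_part_add central_part_scale scale_mult_right)
qed (simp_all add: distrib_right central_part_add central_part_scale scale_mult_left)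

lemma central_fixed_mult:
  "central_part x = x \<Longrightarrow> central_part y = y \<Longrightarrow> central_part (x * y) = x * y"
  by (metis central_part_linear)

lemma scalar_eq_iff: "scale c 1 = scale d 1 \<longleftrightarrow> c = d"
proof
  assume "scale c 1 = scale d 1"
  then have "blade_coeff (scale c 1) {} = blade_coeff (scale d 1) {}" by simp
  then show "c = d"
    using blade_coeff_blade[of "{}" "{}"] by (simp add: blade_coeff_scale blade_empty)
qed simp

lemma scalarI:
  assumes "\<And>S. S \<subseteq> indices \<Longrightarrow> S \<noteq> {} \<Longrightarrow> blade_coeff x S = 0"
  shows "\<exists>c. x = scale c 1"
proof
  show "x = scale (blade_coeff x {}) 1"
  proof (rule blade_eqI)
    fix S assume "S \<subseteq> indices"
    then show "blade_coeff x S = blade_coeff (scale (blade_coeff x {}) 1) S"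
      using assms[of S] blade_coeff_blade[of "{}" S] by (auto simp: blade_coeff_scale blade_empty)
  qed
qed

end

section \<open>Quadratic elements\<close>

locale clifford_algebra_char_0 = clifford_algebra scale e p q
  for scale :: "'k::field_char_0 \<Rightarrow> 'a::ring_1 \<Rightarrow> 'a" and e :: "nat \<Rightarrow> 'a" and p q :: nat
begin

sublocale finite_dimensional_algebra_char_0 scale "blade e ` Pow {1..p + q}"
  by unfold_locales

text \<open>Adding both orders of summation writes \<open>x * x + x * x\<close> as a combination of
  anticommutators of blades. Each one vanishes or is central.\<close>

lemma central_part_square:
  assumes supp: "\<And>S. S \<subseteq> indices \<Longrightarrow> blade_coeff x S \<noteq> 0 \<Longrightarrow> P S"
    and P: "\<And>S T. S \<subseteq> indices \<Longrightarrow> T \<subseteq> indices \<Longrightarrow> P S \<Longrightarrow> P T \<Longrightarrow>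
      odd (card S * card T + card (S \<inter> T)) \<or> central_index (sym_diff S T)"
  shows "central_part (x * x) = x * x"
proof -
  let ?a = "\<lambda>S T. scale (blade_coeff x T * blade_coeff x S) (blade e S * blade e T + blade e T * blade e S)"
  have xx: "x * x = (\<Sum>S\<in>Pow indices. \<Sum>T\<in>Pow indices.
      scale (blade_coeff x T * blade_coeff x S) (blade e S * blade e T))"
    by (subst (1 2) blade_expansion[of x, symmetric])
      (simp add: sum_product scale_mult_left scale_mult_right)
  have xx': "x * x = (\<Sum>S\<in>Pow indices. \<Sum>T\<in>Pow indices.
      scale (blade_coeff x T * blade_coeff x S) (blade e T * blade e S))"
    unfolding xx
    by (subst sum.swap, rule sum.cong[OF refl], rule sum.cong[OF refl]) (simp only: mult.commute)
  have double: "x * x + x * x = (\<Sum>S\<in>Pow indices. \<Sum>T\<in>Pow indices. ?a S T)"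
    unfolding scale_right_distrib sum.distrib by (rule arg_cong2[of _ _ _ _ "(+)", OF xx xx'])
  have term_central: "central_part (?a S T) = ?a S T" if S: "S \<subseteq> indices" and T: "T \<subseteq> indices" for S T
  proof (cases "blade_coeff x S = 0 \<or> blade_coeff x T = 0")
    case True
    then have "blade_coeff x T * blade_coeff x S = 0" by auto
    then show ?thesis
      by (simp only: scale_zero_left central_part_zero)
  next
    case False
    then have "odd (card S * card T + card (S \<inter> T)) \<or> central_index (sym_diff S T)"
      by (intro P S T supp) simp_all
    then show ?thesis
    proof
      assume "odd (card S * card T + card (S \<inter> T))"
      then show ?thesis
        using blade_commute[OF S T] by (simp add: central_part_zero)
    next
      assume "central_index (sym_diff S T)"
      then show ?thesis
        using central_part_blade_mult[OF S T] central_part_blade_mult[OF T S]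
        by (simp add: central_part_add central_part_scale Un_commute)
    qed
  qed
  have sum: "central_part (sum f A) = (\<Sum>i\<in>A. central_part (f i))" for f :: "nat set \<Rightarrow> 'a" and A
    by (induction A rule: infinite_finite_induct) (simp_all add: central_part_zero central_part_add)
  have two: "scale 2 y = y + y" for y
    using scale_left_distrib[of 1 1 y] by simp
  have "scale 2 (central_part (x * x)) = central_part (x * x + x * x)"
    by (simp only: central_part_add two)
  also have "\<dots> = x * x + x * x"
    unfolding double sum
    by (rule sum.cong[OF refl], rule sum.cong[OF refl], rule term_central) simp_all
  also have "\<dots> = scale 2 (x * x)"
    by (simp only: two)
  finally show ?thesis by simp
qed

lemma blade_coeff_conjugation_fixed:
  assumes "conjugation s x = x" "S \<subseteq> indices" "odd (s * card S + (card S choose 2))"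
  shows "blade_coeff x S = 0"
proof -
  have "blade_coeff x S = - blade_coeff x S"
    using blade_coeff_conjugation[OF assms(2), of s x]
    unfolding assms(1) neg_one_odd_power[OF assms(3)] mult_minus1 .
  then have "blade_coeff x S + blade_coeff x S = 0"
    by (rule eq_neg_iff_add_eq_0[THEN iffD1])
  then have "2 * blade_coeff x S = 0"
    by (simp only: mult_2)
  then show ?thesis by simp
qed

text \<open>With \<open>x = z + v\<close> and \<open>z\<close> the central part, the product is
  \<open>(z + v) * (z - v) = z * z - v * v\<close>, so only the square of the noncentral part
  matters.\<close>

lemma central_part_mult_conjugate:
  assumes supp: "\<And>S. S \<subseteq> indices \<Longrightarrow> blade_coeff x S \<noteq> 0 \<Longrightarrow> P S"
    and P: "\<And>S T. S \<subseteq> indices \<Longrightarrow> T \<subseteq> indices \<Longrightarrow> \<not> central_index S \<Longrightarrow> \<not> central_index T \<Longrightarrow> P S \<Longrightarrow> P T \<Longrightarrow>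
      odd (card S * card T + card (S \<inter> T)) \<or> central_index (sym_diff S T)"
  shows "central_part (x * (2 * central_part x - x)) = x * (2 * central_part x - x)"
proof -
  define z v where "z = central_part x" and "v = x - z"
  have "x * (2 * z - x) = (z + v) * (z - v)"
    by (simp add: v_def mult_2 algebra_simps)
  also have "\<dots> = z * z - v * v"
    using central_part_commute[of x v] by (simp add: algebra_simps z_def)
  finally have eq: "x * (2 * z - x) = z * z - v * v" .
  have "central_part (v * v) = v * v"
  proof (rule central_part_square)
    show "P S \<and> \<not> central_index S" if "S \<subseteq> indices" "blade_coeff v S \<noteq> 0" for S
      using that supp[of S]
      by (auto simp: v_def z_def blade_coeff_diff blade_coeff_central_part split: if_splits)
    show "odd (card S * card T + card (S \<inter> T)) \<or> central_index (sym_diff S T)"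
      if "S \<subseteq> indices" "T \<subseteq> indices" "P S \<and> \<not> central_index S" "P T \<and> \<not> central_index T" for S T
      using that by (intro P) simp_all
  qed
  moreover have "central_part (z * z) = z * z"
    by (simp add: z_def central_fixed_mult central_part_central_part)
  moreover have "central_part (a - b) = central_part a - central_part b" for a b
    using central_part_add[of a "- b"] central_part_scale[of "- 1" b] by simp
  ultimately show ?thesis
    unfolding z_def[symmetric] eq by simp
qed

text \<open>Translates conditions on \<open>S\<close> and \<open>T\<close> into arithmetic of the
  cardinalities of \<open>S\<close>, \<open>T\<close> and \<open>S \<inter> T\<close>, where finite
  case distinctions suffice.\<close>

lemma card_sym_diff_cases:
  assumes "S \<subseteq> indices" "T \<subseteq> indices"
  shows "card S \<le> p + q" "card S = p + q \<longleftrightarrow> S = indices" "card S = 0 \<longleftrightarrow> S = {}"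
    "card (S \<inter> T) \<le> card S" "card (S \<inter> T) \<le> card T" "card S + card T \<le> p + q + card (S \<inter> T)"
    "card (S \<inter> T) = card S \<Longrightarrow> card (S \<inter> T) = card T \<Longrightarrow> S = T"
    "card S + card T = p + q \<Longrightarrow> card (S \<inter> T) = 0 \<Longrightarrow> sym_diff S T = indices"
proof -
  note fin = assms[THEN finite_subset_indices]
  have Un: "card (S \<union> T) \<le> p + q" "card (S \<union> T) + card (S \<inter> T) = card S + card T"
    using assms card_mono[OF finite_indices, of "S \<union> T"] card_Un_Int[OF fin]
    by (auto simp: card_indices)
  show "card S \<le> p + q"
    using card_mono[OF finite_indices assms(1)] by (simp add: card_indices)
  show "card S = p + q \<longleftrightarrow> S = indices"
    using card_subset_eq[OF finite_indices assms(1)] by (auto simp: card_indices)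
  show "card S = 0 \<longleftrightarrow> S = {}"
    using fin by simp
  show "card (S \<inter> T) \<le> card S" "card (S \<inter> T) \<le> card T"
    using fin by (simp_all add: card_mono)
  show "card S + card T \<le> p + q + card (S \<inter> T)"
    using Un by simp
  show "S = T" if "card (S \<inter> T) = card S" "card (S \<inter> T) = card T"
    using that card_subset_eq[OF fin(1), of "S \<inter> T"] card_subset_eq[OF fin(2), of "S \<inter> T"] by auto
  show "sym_diff S T = indices" if "card S + card T = p + q" "card (S \<inter> T) = 0"
  proof -
    have "S \<inter> T = {}"
      using that(2) fin by simp
    moreover have "S \<union> T = indices"
      using that Un assms by (intro card_subset_eq[OF finite_indices]) (auto simp: card_indices)
    ultimately show ?thesis by blast
  qed
qed

text \<open>Noncentral fixed blades have sizes 1 and 4 for \<open>s = 0\<close>, and 3 and 4 for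
  \<open>s = 1\<close>. With four generators distinct ones anticommute; with five and
  \<open>s = 0\<close> the only exceptions are complementary pairs, whose product is the
  pseudoscalar up to sign. With five and \<open>s = 1\<close>, two blades of size 3 sharing one
  index would commute with a noncentral product.\<close>

lemma quadratic_involution_conjugation:
  assumes "p + q = 4 \<or> p + q = 5 \<and> s = 0" "s \<le> 1"
  shows "quadratic_involution central_part (conjugation s)"
proof
  fix x assume fixed: "conjugation s x = x"
  show "central_part (x * (2 * central_part x - x)) = x * (2 * central_part x - x)"
  proof (rule central_part_mult_conjugate[where P = "\<lambda>S. even (s * card S + (card S choose 2))"])
    show "even (s * card S + (card S choose 2))" if "S \<subseteq> indices" "blade_coeff x S \<noteq> 0" for S
      using blade_coeff_conjugation_fixed[OF fixed that(1)] that(2) by blast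
    fix S T
    assume ST: "S \<subseteq> indices" "T \<subseteq> indices"
      and noncentral: "\<not> central_index S" "\<not> central_index T"
      and ev: "even (s * card S + (card S choose 2))" "even (s * card T + (card T choose 2))"
    note S = card_sym_diff_cases[OF ST] and T = card_sym_diff_cases[OF ST(2,1)]
    have nonempty: "card S \<noteq> 0" "card T \<noteq> 0"
      using S(3) T(3) noncentral by (simp_all add: central_index_def)
    have card_1_4: "m = 1 \<or> m = 4" if "m \<le> 4" "m \<noteq> 0" "even (m choose 2)" for m
    proof -
      from that consider "m = 1" | "m = 2" | "m = 3" | "m = 4" by linarith
      then show ?thesis using that(3) by cases (simp_all add: choose_two)
    qed
    have card_3_4: "m = 3 \<or> m = 4" if "m \<le> 4" "m \<noteq> 0" "even (m + (m choose 2))" for m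
    proof -
      from that consider "m = 1" | "m = 2" | "m = 3" | "m = 4" by linarith
      then show ?thesis using that(3) by cases (simp_all add: choose_two)
    qed
    \<comment> \<open>\<open>a\<close>, \<open>b\<close>, \<open>c\<close> stand for the
      cardinalities of \<open>S\<close>, \<open>T\<close>, \<open>S \<inter> T\<close>;
      \<open>c = a \<and> c = b\<close> means \<open>S = T\<close>. The last premise says that the
      union fits into the index set.\<close>
    have odd_1_4: "odd (a * b + c) \<or> c = a \<and> c = b"
      if "a = 1 \<or> a = 4" "b = 1 \<or> b = 4" "c \<le> a" "c \<le> b" "a + b \<le> 4 + c" for a b c :: nat
      using that by (elim disjE; simp; presburger)
    have odd_3_4: "odd (a * b + c) \<or> c = a \<and> c = b"
      if "a = 3 \<or> a = 4" "b = 3 \<or> b = 4" "c \<le> a" "c \<le> b" "a + b \<le> 4 + c" for a b c :: nat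
      using that by (elim disjE; simp; presburger)
    have odd_1_4': "odd (a * b + c) \<or> c = a \<and> c = b \<or> a + b = 5 \<and> c = 0"
      if "a = 1 \<or> a = 4" "b = 1 \<or> b = 4" "c \<le> a" "c \<le> b" "a + b \<le> 5 + c" for a b c :: nat
      using that by (elim disjE; simp; presburger)
    consider "p + q = 4" "s = 0" | "p + q = 4" "s = 1" | "p + q = 5" "s = 0"
      using assms by linarith
    then have "odd (card S * card T + card (S \<inter> T)) \<or> card (S \<inter> T) = card S \<and> card (S \<inter> T) = card T \<or>
        p + q = 5 \<and> card S + card T = p + q \<and> card (S \<inter> T) = 0"
    proof cases
      case 1
      have "card S \<le> 4" "card T \<le> 4"
        using S(1) T(1) 1 by linarith+
      then have "card S = 1 \<or> card S = 4" "card T = 1 \<or> card T = 4"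
        using card_1_4[of "card S"] card_1_4[of "card T"] nonempty ev 1 by simp_all
      then show ?thesis
        using odd_1_4[of "card S" "card T" "card (S \<inter> T)"] S(4,5,6) 1 by simp
    next
      case 2
      have "card S \<le> 4" "card T \<le> 4"
        using S(1) T(1) 2 by linarith+
      then have "card S = 3 \<or> card S = 4" "card T = 3 \<or> card T = 4"
        using card_3_4[of "card S"] card_3_4[of "card T"] nonempty ev 2 by simp_all
      then show ?thesis
        using odd_3_4[of "card S" "card T" "card (S \<inter> T)"] S(4,5,6) 2 by simp
    next
      case 3
      have "card S \<noteq> 5" "card T \<noteq> 5"
        using S(2) T(2) noncentral 3 by (auto simp: central_index_def)
      then have "card S \<le> 4" "card T \<le> 4"
        using S(1) T(1) 3 by linarith+
      then have "card S = 1 \<or> card S = 4" "card T = 1 \<or> card T = 4"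
        using card_1_4[of "card S"] card_1_4[of "card T"] nonempty ev 3 by simp_all
      then show ?thesis
        using odd_1_4'[of "card S" "card T" "card (S \<inter> T)"] S(4,5,6) 3 by simp
    qed
    then consider "odd (card S * card T + card (S \<inter> T))" | "S = T" | "sym_diff S T = indices" "odd (p + q)"
      using S(7,8) by fastforce
    then show "odd (card S * card T + card (S \<inter> T)) \<or> central_index (sym_diff S T)"
      by cases (simp_all add: central_index_def)
  qed
qed (rule central_part_add central_part_one central_part_commute central_part_linear
    central_part_mult_commute conjugation_mult conjugation_conjugation)+

end

section \<open>Determinants of Clifford algebras\<close>

context clifford_algebra_char_0
begin

section \<open>The degree bound for Clifford algebras\<close>

lemma blade_coeff_blade_mult:
  assumes "S \<subseteq> indices" "T \<subseteq> indices" "S \<noteq> T"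
  shows "blade_coeff (blade e S * blade e T) {} = 0"
proof -
  have "sym_diff S T \<subseteq> indices" "sym_diff S T \<noteq> {}"
    using assms by auto
  moreover obtain k where "blade e S * blade e T = sign k (blade e (sym_diff S T))"
    using blade_mult_blade[OF assms(1,2)] by blast
  ultimately show ?thesis
    by (simp only: blade_coeff_scale blade_coeff_blade[OF _ empty_subsetI]) simp
qed

lemma blade_square:
  assumes "S \<subseteq> indices"
  shows "blade e S * blade e S = 1 \<or> blade e S * blade e S = - 1"
proof -
  obtain k where "blade e S * blade e S = sign k (blade e (sym_diff S S))"
    using blade_mult_blade[OF assms assms] by blast
  then have "blade e S * blade e S = sign k 1"
    by (simp add: blade_empty)
  then show ?thesis
    by (cases "even k") simp_all
qed

text \<open>The blades on {1}, {2, 3}, {4, 5} are disjoint and at most one has odd size, so they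
  commute. Their nonempty products are nonscalar blades up to sign, hence have coefficient 0 at 1.
  The signature affects only the signs of the squares, which may be arbitrary.\<close>

lemma determinant_like_degree_ge_clifford:
  assumes D: "determinant_like D" and n: "1 \<le> p + q" "p + q \<le> 5"
  shows "2 ^ ((p + q + 1) div 2) \<le> polynomial_function_degree D"
proof -
  define u1 u2 u3 where "u1 = blade e {1}" and "u2 = blade e {2, 3}" and "u3 = blade e {4, 5}"
  have sub: "{1} \<subseteq> indices" "3 \<le> p + q \<Longrightarrow> {2, 3} \<subseteq> indices" "5 \<le> p + q \<Longrightarrow> {4, 5} \<subseteq> indices"
    "5 \<le> p + q \<Longrightarrow> {2, 3, 4, 5} \<subseteq> indices"
    using n by (auto simp: indices_def)
  have coeff1: "blade_coeff u1 {} = 0"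
    using blade_coeff_blade[OF sub(1), of "{}"] by (simp add: u1_def)
  have sq1: "u1 * u1 = 1 \<or> u1 * u1 = - 1"
    unfolding u1_def by (rule blade_square[OF sub(1)])
  have coeff2: "blade_coeff u2 {} = 0" "blade_coeff (u1 * u2) {} = 0"
    and sq2: "u2 * u2 = 1 \<or> u2 * u2 = - 1" and comm2: "u1 * u2 = u2 * u1" if "3 \<le> p + q"
  proof -
    note s = sub(2)[OF that]
    show "blade_coeff u2 {} = 0"
      using blade_coeff_blade[OF s, of "{}"] by (simp add: u2_def)
    have "{1} \<noteq> {2, 3 :: nat}" by auto
    then show "blade_coeff (u1 * u2) {} = 0"
      unfolding u1_def u2_def by (rule blade_coeff_blade_mult[OF sub(1) s])
    show "u2 * u2 = 1 \<or> u2 * u2 = - 1"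
      unfolding u2_def by (rule blade_square[OF s])
    show "u1 * u2 = u2 * u1"
      using blade_commute[OF sub(1) s] by (simp add: u1_def u2_def)
  qed
  have coeff3: "blade_coeff u3 {} = 0" "blade_coeff (u1 * u3) {} = 0" "blade_coeff (u2 * u3) {} = 0"
      "blade_coeff (u1 * (u2 * u3)) {} = 0"
    and sq3: "u3 * u3 = 1 \<or> u3 * u3 = - 1" and comm3: "u1 * u3 = u3 * u1" "u2 * u3 = u3 * u2"
    if "5 \<le> p + q"
  proof -
    have s2: "{2, 3} \<subseteq> indices"
      using sub(2) that by simp
    note s = sub(3,4)[OF that]
    show "blade_coeff u3 {} = 0"
      using blade_coeff_blade[OF s(1), of "{}"] by (simp add: u3_def)
    have "{1} \<noteq> {4, 5 :: nat}" by auto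
    then show "blade_coeff (u1 * u3) {} = 0"
      unfolding u1_def u3_def by (rule blade_coeff_blade_mult[OF sub(1) s(1)])
    have "4 \<in> {4, 5 :: nat}" "4 \<notin> {2, 3 :: nat}" by auto
    then have "{2, 3 :: nat} \<noteq> {4, 5}" by metis
    then show "blade_coeff (u2 * u3) {} = 0"
      unfolding u2_def u3_def by (rule blade_coeff_blade_mult[OF s2 s(1)])
    have "sym_diff {2, 3} {4, 5} = {2, 3, 4, 5 :: nat}" by auto
    with blade_mult_blade[OF s2 s(1)] obtain k where k: "u2 * u3 = sign k (blade e {2, 3, 4, 5})"
      unfolding u2_def u3_def by metis
    have "{1} \<noteq> {2, 3, 4, 5 :: nat}" by auto
    then have "blade_coeff (u1 * blade e {2, 3, 4, 5}) {} = 0"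
      unfolding u1_def by (rule blade_coeff_blade_mult[OF sub(1) s(2)])
    then show "blade_coeff (u1 * (u2 * u3)) {} = 0"
      by (simp only: k scale_mult_right blade_coeff_scale mult_zero_right)
    show "u3 * u3 = 1 \<or> u3 * u3 = - 1"
      unfolding u3_def by (rule blade_square[OF s(1)])
    show "u1 * u3 = u3 * u1"
      using blade_commute[OF sub(1) s(1)] by (simp add: u1_def u3_def)
    show "u2 * u3 = u3 * u2"
      using blade_commute[OF s2 s(1)] by (simp add: u2_def u3_def)
  qed
  note deg = determinant_like_degree_ge[OF D, of "\<lambda>x. blade_coeff x {}"]
  have one: "blade_coeff 1 {} = 1"
    using blade_coeff_blade[of "{}" "{}"] by (simp add: blade_empty)
  consider "(p + q + 1) div 2 = 1" | "(p + q + 1) div 2 = 2" "3 \<le> p + q" | "(p + q + 1) div 2 = 3" "5 \<le> p + q"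
    using n by linarith
  then show ?thesis
  proof cases
    case 1
    have "2 ^ length [u1] \<le> polynomial_function_degree D"
      by (rule deg) (use sq1 coeff1 in \<open>auto simp: blade_coeff_add blade_coeff_scale one\<close>)
    with 1 show ?thesis by simp
  next
    case 2
    have "2 ^ length [u1, u2] \<le> polynomial_function_degree D"
      by (rule deg) (use sq1 coeff1 sq2[OF 2(2)] coeff2[OF 2(2)] comm2[OF 2(2)] in
          \<open>auto simp: blade_coeff_add blade_coeff_scale one\<close>)
    with 2 show ?thesis by simp
  next
    case 3
    then have "3 \<le> p + q" by simp
    have "2 ^ length [u1, u2, u3] \<le> polynomial_function_degree D"
      by (rule deg) (use sq1 coeff1 sq2 coeff2 comm2 sq3 coeff3 comm3 \<open>3 \<le> p + q\<close> 3(2) in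
          \<open>auto simp: blade_coeff_add blade_coeff_scale one\<close>)
    with 3 show ?thesis by simp
  qed
qed

text \<open>The degree bound on \<open>F\<close> equals the lower bound for all competitors, so
  \<open>F\<close> is least. If \<open>F \<alpha>\<close> is a nonzero scalar, writing it as a right
  and as a left multiple of \<open>\<alpha>\<close> gives a two-sided inverse.\<close>

lemma is_determinant_mapI:
  assumes n: "1 \<le> p + q" "p + q \<le> 5"
    and scalar: "\<And>\<alpha>. \<exists>c. F \<alpha> = scale c 1" and one: "F 1 = 1" and mult: "\<And>\<alpha> \<beta>. F (\<alpha> * \<beta>) = F \<alpha> * F \<beta>"
    and right: "\<And>\<alpha>. \<exists>\<beta>. \<alpha> * \<beta> = F \<alpha>" and left: "\<And>\<alpha>. \<exists>\<beta>. \<beta> * \<alpha> = F \<alpha>"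
    and poly: "polynomial_map_deg_le (2 ^ ((p + q + 1) div 2)) F"
  shows "is_determinant_map F"
proof -
  define D where "D \<alpha> = blade_coeff (F \<alpha>) {}" for \<alpha>
  have blade_coeff_one: "blade_coeff 1 {} = 1"
    using blade_coeff_blade[of "{}" "{}"] by (simp add: blade_empty)
  have F: "F \<alpha> = scale (D \<alpha>) 1" for \<alpha>
    using scalar[of \<alpha>] by (auto simp: D_def blade_coeff_scale blade_coeff_one)
  have D_mult: "D (\<alpha> * \<beta>) = D \<alpha> * D \<beta>" for \<alpha> \<beta>
  proof -
    have "scale (D (\<alpha> * \<beta>)) 1 = scale (D \<alpha> * D \<beta>) 1"
      using mult[of \<alpha> \<beta>] unfolding F by (simp add: scale_mult_left)
    then show ?thesis by (simp only: scalar_eq_iff)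
  qed
  have D_one: "D 1 = 1"
    by (simp add: D_def one blade_coeff_one)
  have D_inv: "is_invertible \<alpha> \<longleftrightarrow> is_invertible (D \<alpha>)" for \<alpha>
    unfolding is_invertible_field_iff
  proof
    assume "is_invertible \<alpha>"
    then obtain \<beta> where "\<alpha> * \<beta> = 1"
      unfolding is_invertible_def by blast
    then have "D \<alpha> * D \<beta> = 1"
      using D_mult[of \<alpha> \<beta>] D_one by simp
    then show "D \<alpha> \<noteq> 0" by auto
  next
    assume nz: "D \<alpha> \<noteq> 0"
    obtain \<beta> \<gamma> where "\<alpha> * \<beta> = F \<alpha>" "\<gamma> * \<alpha> = F \<alpha>"
      using left right by metis
    then have inv: "\<alpha> * scale (1 / D \<alpha>) \<beta> = 1" "scale (1 / D \<alpha>) \<gamma> * \<alpha> = 1"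
      using nz by (simp_all add: scale_mult_left scale_mult_right F)
    then have "scale (1 / D \<alpha>) \<gamma> = scale (1 / D \<alpha>) \<beta>"
      by (metis mult.assoc mult_1_left mult_1_right)
    with inv show "is_invertible \<alpha>"
      unfolding is_invertible_def by metis
  qed
  have "blade e {} \<in> blade e ` Pow {1..p + q}" by blast
  then have deg: "polynomial_function_deg_le (2 ^ ((p + q + 1) div 2)) D"
    using poly unfolding polynomial_map_deg_le_def D_def blade_coeff_def by blast
  then have like: "determinant_like D"
    unfolding determinant_like_def polynomial_function_def using D_mult D_inv by blast
  have "is_determinant D"
    unfolding is_determinant_def
  proof (intro conjI allI impI)
    fix D' assume "determinant_like D'"
    then show "polynomial_function_degree D \<le> polynomial_function_degree D'"
      using polynomial_function_degree_le[OF deg] determinant_like_degree_ge_clifford[OF _ n]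
      by (meson order_trans)
  qed (fact like)
  with F show ?thesis
    unfolding is_determinant_map_def by blast
qed

lemma psi4_eq:
  assumes "p + q = 4"
  shows "psi4 x = 2 * central_part x - x"
proof (induction x rule: blade_induct)
  case (1 S)
  have "central_index S \<longleftrightarrow> S = {}"
    using assms by (auto simp: central_index_def)
  then show ?case
    using 1 by (simp add: psi4_def extend_linearly_blade central_part_blade mult_2)
next
  case (2 x y)
  have "psi4 (x + y) = psi4 x + psi4 y"
    by (simp only: psi4_def extend_linearly_add)
  then show ?case
    unfolding 2 by (simp add: central_part_add algebra_simps)
next
  case (3 c x)
  then show ?case
    by (simp add: psi4_def extend_linearly_scale central_part_scale scale_mult_right scale_right_diff_distrib)
qed

text \<open>With five generators the pseudoscalar is central and therefore kept, whereas
  \<open>psi4\<close> negates the pseudoscalar of four generators.\<close>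

lemma psi5_eq:
  assumes "p + q = 5"
  shows "psi5 x = 2 * central_part x - x"
proof (induction x rule: blade_induct)
  case (1 S)
  have "central_index S \<longleftrightarrow> S = {} \<or> S = {1..5}"
    using assms by (auto simp: central_index_def indices_def)
  then show ?case
    using 1 by (simp only: psi5_def extend_linearly_blade central_part_blade) (simp add: mult_2)
next
  case (2 x y)
  have "psi5 (x + y) = psi5 x + psi5 y"
    by (simp only: psi5_def extend_linearly_add)
  then show ?case
    unfolding 2 by (simp add: central_part_add algebra_simps)
next
  case (3 c x)
  then show ?case
    by (simp add: psi5_def extend_linearly_scale central_part_scale scale_mult_right scale_right_diff_distrib)
qed

section \<open>Norms from the center to the scalars\<close>

lemma conjugation_central: "central_part z = z \<Longrightarrow> central_part (conjugation s z) = conjugation s z"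
  by (simp add: central_part_eq_iff blade_coeff_conjugation)

lemma center_commute: "central_part z = z \<Longrightarrow> z * x = x * z"
  using central_part_commute[of z x] by simp

text \<open>The product is central and fixed by the conjugation. A pseudoscalar component would
  change sign, so it vanishes.\<close>

lemma center_mult_conjugation_scalar:
  assumes z: "central_part z = z" and odd: "odd (p + q) \<Longrightarrow> odd (s * (p + q) + (p + q choose 2))"
  shows "\<exists>c. z * conjugation s z = scale c 1"
proof (rule scalarI)
  fix S assume S: "S \<subseteq> indices" "S \<noteq> {}"
  have fixed: "conjugation s (z * conjugation s z) = z * conjugation s z"
    by (simp add: conjugation_mult conjugation_conjugation)
  have central: "central_part (z * conjugation s z) = z * conjugation s z"
    by (rule central_fixed_mult[OF z conjugation_central[OF z]])
  show "blade_coeff (z * conjugation s z) S = 0"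
  proof (cases "central_index S")
    case True
    with S have "S = indices" and "odd (p + q)"
      by (auto simp: central_index_def)
    then have "odd (s * card S + (card S choose 2))"
      using odd card_indices by metis
    then show ?thesis
      by (rule blade_coeff_conjugation_fixed[OF fixed S(1)])
  next
    case False
    then show ?thesis
      using central S(1) unfolding central_part_eq_iff by blast
  qed
qed

lemma center_scalar:
  assumes "central_part z = z" "even (p + q)"
  shows "\<exists>c. z = scale c 1"
proof (rule scalarI)
  fix S assume "S \<subseteq> indices" "S \<noteq> {}"
  then show "blade_coeff z S = 0"
    using assms unfolding central_part_eq_iff by (auto simp: central_index_def)
qed

text \<open>The final step for three and five generators: the norm of the two-dimensional center
  doubles the degree \<open>d\<close>. Centrality lets conjugates move freely, which preserves
  multiplicativity.\<close>

lemma is_determinant_map_center_norm: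
  assumes n: "1 \<le> p + q" "p + q \<le> 5"
    and odd: "odd (p + q) \<Longrightarrow> odd (s * (p + q) + (p + q choose 2))"
    and central: "\<And>\<alpha>. central_part (N \<alpha>) = N \<alpha>"
    and one: "N 1 = 1" and mult: "\<And>\<alpha> \<beta>. N (\<alpha> * \<beta>) = N \<alpha> * N \<beta>"
    and right: "\<And>\<alpha>. \<exists>\<beta>. \<alpha> * \<beta> = N \<alpha>" and left: "\<And>\<alpha>. \<exists>\<beta>. \<beta> * \<alpha> = N \<alpha>"
    and poly: "polynomial_map_deg_le d N" and d: "d + d = 2 ^ ((p + q + 1) div 2)"
  shows "is_determinant_map (\<lambda>\<alpha>. N \<alpha> * conjugation s (N \<alpha>))"
proof (rule is_determinant_mapI[OF n])
  show "\<exists>c. N \<alpha> * conjugation s (N \<alpha>) = scale c 1" for \<alpha>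
    by (rule center_mult_conjugation_scalar[OF central odd])
  show "N 1 * conjugation s (N 1) = 1"
    by (simp add: one conjugation_one)
  show "N (\<alpha> * \<beta>) * conjugation s (N (\<alpha> * \<beta>)) =
      N \<alpha> * conjugation s (N \<alpha>) * (N \<beta> * conjugation s (N \<beta>))" for \<alpha> \<beta>
  proof -
    have "N (\<alpha> * \<beta>) * conjugation s (N (\<alpha> * \<beta>)) =
        N \<alpha> * ((N \<beta> * conjugation s (N \<beta>)) * conjugation s (N \<alpha>))"
      by (simp add: mult conjugation_mult mult.assoc)
    also have "(N \<beta> * conjugation s (N \<beta>)) * conjugation s (N \<alpha>) =
        conjugation s (N \<alpha>) * (N \<beta> * conjugation s (N \<beta>))"
      by (rule center_commute[OF conjugation_central[OF central], symmetric])
    finally show ?thesis by (simp add: mult.assoc)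
  qed
  show "\<exists>\<beta>. \<alpha> * \<beta> = N \<alpha> * conjugation s (N \<alpha>)" for \<alpha>
    using right[of \<alpha>] by (metis mult.assoc)
  show "\<exists>\<beta>. \<beta> * \<alpha> = N \<alpha> * conjugation s (N \<alpha>)" for \<alpha>
    using left[of \<alpha>] center_commute[OF central] by (metis mult.assoc)
  have "polynomial_map_deg_le d (\<lambda>\<alpha>. conjugation s (N \<alpha>))"
    by (rule polynomial_map_deg_le_linear[OF poly conjugation_add conjugation_scale])
  from polynomial_map_deg_le_mult[OF poly this]
  show "polynomial_map_deg_le (2 ^ ((p + q + 1) div 2)) (\<lambda>\<alpha>. N \<alpha> * conjugation s (N \<alpha>))"
    by (simp only: d)
qed

lemma polynomial_map_mult_conjugation: "polynomial_map_deg_le 2 (\<lambda>\<alpha>. \<alpha> * conjugation s \<alpha>)"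
proof -
  have "polynomial_map_deg_le 1 (conjugation s)"
    by (rule polynomial_map_deg_le_linear[OF polynomial_map_deg_le_id, of "conjugation s"])
      (rule conjugation_add conjugation_scale)+
  from polynomial_map_deg_le_mult[OF polynomial_map_deg_le_id this] show ?thesis
    by (simp only: one_add_one)
qed

text \<open>Clifford conjugation negates sizes 1 and 2. Size 3 survives, but then
  \<open>p + q = 3\<close> and the blade is the central pseudoscalar.\<close>

lemma clifford_fixed_central:
  assumes n: "p + q \<le> 3" and fixed: "conjugation 1 x = x"
  shows "central_part x = x"
  unfolding central_part_eq_iff
proof (intro allI impI)
  fix S assume S: "S \<subseteq> indices" "blade_coeff x S \<noteq> 0"
  then have ev: "even (card S + (card S choose 2))"
    using blade_coeff_conjugation_fixed[OF fixed S(1)] by auto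
  note c = card_sym_diff_cases(1-3)[OF S(1) S(1)]
  have "card S \<le> 3"
    using c(1) n by linarith
  then consider "card S = 0" | "card S = 1" | "card S = 2" | "card S = 3" by linarith
  then show "central_index S"
  proof cases
    case 4
    then have "p + q = 3" using c(1) n by linarith
    then show ?thesis using c(2) 4 by (simp add: central_index_def)
  qed (use c(3) ev in \<open>simp_all add: central_index_def choose_two\<close>)
qed

lemma clifford_norm_central:
  "p + q \<le> 3 \<Longrightarrow> central_part (\<alpha> * conjugation 1 \<alpha>) = \<alpha> * conjugation 1 \<alpha>"
  "p + q \<le> 3 \<Longrightarrow> central_part (conjugation 1 \<alpha> * \<alpha>) = conjugation 1 \<alpha> * \<alpha>"
  by (simp_all add: clifford_fixed_central conjugation_mult conjugation_conjugation)

text \<open>Both products are central, hence equal to their central parts, which agree by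
  cyclicity.\<close>

lemma clifford_norm_commute:
  "p + q \<le> 3 \<Longrightarrow> conjugation 1 \<alpha> * \<alpha> = \<alpha> * conjugation 1 \<alpha>"
  by (metis clifford_norm_central central_part_mult_commute)

lemma clifford_norm_mult:
  assumes "p + q \<le> 3"
  shows "(\<alpha> * \<beta>) * conjugation 1 (\<alpha> * \<beta>) = (\<alpha> * conjugation 1 \<alpha>) * (\<beta> * conjugation 1 \<beta>)"
proof -
  have "(\<alpha> * \<beta>) * conjugation 1 (\<alpha> * \<beta>) = \<alpha> * ((\<beta> * conjugation 1 \<beta>) * conjugation 1 \<alpha>)"
    by (simp add: conjugation_mult mult.assoc)
  also have "(\<beta> * conjugation 1 \<beta>) * conjugation 1 \<alpha> = conjugation 1 \<alpha> * (\<beta> * conjugation 1 \<beta>)"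
    by (rule center_commute[OF clifford_norm_central(1)[OF assms]])
  finally show ?thesis by (simp add: mult.assoc)
qed

lemma is_determinant_map_1_2:
  assumes n: "p + q = 1 \<or> p + q = 2"
  shows "is_determinant_map (\<lambda>\<alpha>. \<alpha> * clifford_conj \<alpha>)" "is_determinant_map (\<lambda>\<alpha>. clifford_conj \<alpha> * \<alpha>)"
proof -
  have le: "p + q \<le> 3" and n': "1 \<le> p + q" "p + q \<le> 5" and k: "(p + q + 1) div 2 = 1"
    using n by auto
  show 1: "is_determinant_map (\<lambda>\<alpha>. \<alpha> * clifford_conj \<alpha>)"
    unfolding clifford_conj_eq
  proof (rule is_determinant_mapI[OF n'])
    show "\<exists>c. \<alpha> * conjugation 1 \<alpha> = scale c 1" for \<alpha>
    proof (rule scalarI)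
      fix S assume S: "S \<subseteq> indices" "S \<noteq> {}"
      have fixed: "conjugation 1 (\<alpha> * conjugation 1 \<alpha>) = \<alpha> * conjugation 1 \<alpha>"
        by (simp add: conjugation_mult conjugation_conjugation)
      have "card S = 1 \<or> card S = 2"
        using card_sym_diff_cases(1,3)[OF S(1) S(1)] S(2) n by auto
      \<comment> \<open>Sizes 1 and 2 give 1 + 0 and 2 + 1, so every nonscalar blade is negated,
        even for \<open>p + q = 1\<close>, where the whole algebra is commutative.\<close>
      then have "odd (1 * card S + (card S choose 2))"
        by (auto simp: choose_two)
      then show "blade_coeff (\<alpha> * conjugation 1 \<alpha>) S = 0"
        by (rule blade_coeff_conjugation_fixed[OF fixed S(1)])
    qed
    show "\<exists>\<beta>. \<beta> * \<alpha> = \<alpha> * conjugation 1 \<alpha>" for \<alpha>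
      using clifford_norm_commute[OF le] by blast
    show "polynomial_map_deg_le (2 ^ ((p + q + 1) div 2)) (\<lambda>\<alpha>. \<alpha> * conjugation 1 \<alpha>)"
      unfolding k power_one_right by (rule polynomial_map_mult_conjugation)
    show "\<alpha> * \<beta> * conjugation 1 (\<alpha> * \<beta>) = \<alpha> * conjugation 1 \<alpha> * (\<beta> * conjugation 1 \<beta>)" for \<alpha> \<beta>
      by (rule clifford_norm_mult[OF le])
  qed (auto simp: conjugation_one)
  then show "is_determinant_map (\<lambda>\<alpha>. clifford_conj \<alpha> * \<alpha>)"
    by (simp only: clifford_conj_eq clifford_norm_commute[OF le])
qed

text \<open>All four maps are the same function \<open>N \<alpha> * reversion (N \<alpha>)\<close>.
  In the last two the inner factors combine to \<open>N (reversion \<alpha>)\<close>, which is the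
  central element \<open>reversion (N \<alpha>)\<close> and can be moved out.\<close>

lemma is_determinant_map_3:
  assumes n: "p + q = 3"
  shows "is_determinant_map (\<lambda>\<alpha>. (\<alpha> * clifford_conj \<alpha>) * reversion (\<alpha> * clifford_conj \<alpha>))"
    and "is_determinant_map (\<lambda>\<alpha>. reversion (clifford_conj \<alpha> * \<alpha>) * (clifford_conj \<alpha> * \<alpha>))"
    and "is_determinant_map (\<lambda>\<alpha>. (\<alpha> * reversion \<alpha>) * clifford_conj (\<alpha> * reversion \<alpha>))"
    and "is_determinant_map (\<lambda>\<alpha>. clifford_conj (reversion \<alpha> * \<alpha>) * (reversion \<alpha> * \<alpha>))"
proof -
  have le: "p + q \<le> 3" using n by simp
  let ?\<mu> = "conjugation 1" and ?\<nu> = "conjugation 0"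
  define N where "N \<alpha> = \<alpha> * ?\<mu> \<alpha>" for \<alpha>
  have N': "?\<mu> \<alpha> * \<alpha> = N \<alpha>" for \<alpha>
    by (simp only: N_def clifford_norm_commute[OF le])
  have central: "central_part (N \<alpha>) = N \<alpha>" for \<alpha>
    unfolding N_def by (rule clifford_norm_central[OF le])
  have commute: "?\<nu> (N \<alpha>) * x = x * ?\<nu> (N \<alpha>)" for \<alpha> x
    by (rule center_commute[OF conjugation_central[OF central]])
  have N_reversion: "N (?\<nu> \<alpha>) = ?\<nu> (N \<alpha>)" for \<alpha>
  proof -
    have "?\<nu> (N \<alpha>) = ?\<nu> \<alpha> * ?\<nu> (?\<mu> \<alpha>)"
      by (simp only: conjugation_mult flip: N')
    then show ?thesis
      by (simp only: N_def conjugation_commute[of 0 1])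
  qed
  have det: "is_determinant_map (\<lambda>\<alpha>. N \<alpha> * ?\<nu> (N \<alpha>))"
  proof (rule is_determinant_map_center_norm)
    show "\<exists>\<beta>. \<alpha> * \<beta> = N \<alpha>" "\<exists>\<beta>. \<beta> * \<alpha> = N \<alpha>" for \<alpha>
      using N' by (auto simp: N_def)
    show "N (\<alpha> * \<beta>) = N \<alpha> * N \<beta>" for \<alpha> \<beta>
      unfolding N_def by (rule clifford_norm_mult[OF le])
    show "polynomial_map_deg_le 2 N"
      unfolding N_def by (rule polynomial_map_mult_conjugation)
  qed (simp_all add: n central N_def[of 1] conjugation_one choose_two)
  then show "is_determinant_map (\<lambda>\<alpha>. (\<alpha> * clifford_conj \<alpha>) * reversion (\<alpha> * clifford_conj \<alpha>))"
    by (simp only: clifford_conj_eq reversion_eq N_def)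
  show "is_determinant_map (\<lambda>\<alpha>. reversion (clifford_conj \<alpha> * \<alpha>) * (clifford_conj \<alpha> * \<alpha>))"
    using det by (simp only: clifford_conj_eq reversion_eq N' commute)
  have "(\<alpha> * ?\<nu> \<alpha>) * ?\<mu> (\<alpha> * ?\<nu> \<alpha>) = N \<alpha> * ?\<nu> (N \<alpha>)" for \<alpha>
  proof -
    have "(\<alpha> * ?\<nu> \<alpha>) * ?\<mu> (\<alpha> * ?\<nu> \<alpha>) = \<alpha> * (N (?\<nu> \<alpha>) * ?\<mu> \<alpha>)"
      by (simp add: conjugation_mult N_def mult.assoc)
    then show ?thesis
      by (simp only: N_reversion commute) (simp add: N_def mult.assoc)
  qed
  with det show "is_determinant_map (\<lambda>\<alpha>. (\<alpha> * reversion \<alpha>) * clifford_conj (\<alpha> * reversion \<alpha>))"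
    by (simp only: clifford_conj_eq reversion_eq)
  have "?\<mu> (?\<nu> \<alpha> * \<alpha>) * (?\<nu> \<alpha> * \<alpha>) = N \<alpha> * ?\<nu> (N \<alpha>)" for \<alpha>
  proof -
    have "?\<mu> (?\<nu> \<alpha> * \<alpha>) * (?\<nu> \<alpha> * \<alpha>) = ?\<mu> \<alpha> * (N (?\<nu> \<alpha>) * \<alpha>)"
      by (simp add: conjugation_mult mult.assoc flip: N')
    then show ?thesis
      by (simp only: N_reversion commute) (simp only: N' flip: mult.assoc)
  qed
  with det show "is_determinant_map (\<lambda>\<alpha>. clifford_conj (reversion \<alpha> * \<alpha>) * (reversion \<alpha> * \<alpha>))"
    by (simp only: clifford_conj_eq reversion_eq)
qed

section \<open>Four and five generators\<close>

definition quadratic_norm :: "nat \<Rightarrow> 'a \<Rightarrow> 'a" where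
  "quadratic_norm s \<alpha> = (\<alpha> * conjugation s \<alpha>) * (2 * central_part (\<alpha> * conjugation s \<alpha>) - \<alpha> * conjugation s \<alpha>)"

lemma quadratic_norm_properties:
  assumes "p + q = 4 \<or> p + q = 5 \<and> s = 0" "s \<le> 1"
  shows "central_part (quadratic_norm s \<alpha>) = quadratic_norm s \<alpha>"
    and "quadratic_norm s 1 = 1"
    and "quadratic_norm s (\<alpha> * \<beta>) = quadratic_norm s \<alpha> * quadratic_norm s \<beta>"
    and "(2 * central_part (conjugation s \<alpha> * \<alpha>) - conjugation s \<alpha> * \<alpha>) * (conjugation s \<alpha> * \<alpha>) = quadratic_norm s \<alpha>"
    and "polynomial_map_deg_le 4 (quadratic_norm s)"
proof -
  interpret Q: quadratic_involution central_part "conjugation s"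
    by (rule quadratic_involution_conjugation[OF assms])
  have N: "quadratic_norm s \<alpha> = Q.quad (\<alpha> * conjugation s \<alpha>)" for \<alpha>
    by (simp add: quadratic_norm_def Q.quad_def)
  have quad_mult: "Q.quad (\<alpha> * y * conjugation s \<alpha>) = Q.quad y * Q.quad (conjugation s \<alpha> * \<alpha>)"
    if "conjugation s y = y" for \<alpha> y
    by (rule Q.quad_mult[OF conjugation_add that])
  have quad_one: "Q.quad 1 = 1"
    by (simp add: Q.quad_def central_part_one)
  have N': "quadratic_norm s \<alpha> = Q.quad (conjugation s \<alpha> * \<alpha>)" for \<alpha>
    \<comment> \<open>With the middle factor 1, the norm is the same for both orders of
      \<open>\<alpha>\<close> and its conjugate. This gives the mirrored maps and exhibits the norm
      as a left multiple of \<open>\<alpha>\<close>.\<close>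
    using quad_mult[of 1 \<alpha>] by (simp add: N quad_one conjugation_one)
  show central: "central_part (quadratic_norm s \<alpha>) = quadratic_norm s \<alpha>" for \<alpha>
    using Q.trace_quadratic[of "\<alpha> * conjugation s \<alpha>"]
    by (simp add: quadratic_norm_def conjugation_mult conjugation_conjugation)
  show "quadratic_norm s 1 = 1"
    by (simp add: N quad_one conjugation_one)
  have "quadratic_norm s (\<alpha> * \<beta>) = Q.quad (\<alpha> * (\<beta> * conjugation s \<beta>) * conjugation s \<alpha>)"
    by (simp add: N conjugation_mult mult.assoc)
  \<comment> \<open>\<open>quad_mult\<close> applies to the fixed middle factor
    \<open>\<beta> * conjugation s \<beta>\<close>. The norms appear in reversed order, which
    centrality repairs.\<close>
  also have "\<dots> = quadratic_norm s \<beta> * quadratic_norm s \<alpha>"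
    by (subst quad_mult) (simp_all add: N[of \<beta>] N'[of \<alpha>] conjugation_mult conjugation_conjugation)
  also have "\<dots> = quadratic_norm s \<alpha> * quadratic_norm s \<beta>"
    by (rule center_commute[OF central])
  finally show "quadratic_norm s (\<alpha> * \<beta>) = quadratic_norm s \<alpha> * quadratic_norm s \<beta>" .
  have "(2 * central_part x - x) * x = Q.quad x" for x
    using central_part_commute[of x x] by (simp add: Q.quad_def algebra_simps mult_2)
  then show "(2 * central_part (conjugation s \<alpha> * \<alpha>) - conjugation s \<alpha> * \<alpha>) * (conjugation s \<alpha> * \<alpha>) = quadratic_norm s \<alpha>"
    by (simp only: N')
  have "polynomial_map_deg_le 2 (\<lambda>\<alpha>. 2 * central_part (\<alpha> * conjugation s \<alpha>) - \<alpha> * conjugation s \<alpha>)"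
    by (rule polynomial_map_deg_le_linear[OF polynomial_map_mult_conjugation, where L = "\<lambda>x. 2 * central_part x - x"])
      (simp_all add: central_part_add central_part_scale algebra_simps scale_mult_right scale_right_diff_distrib)
  from polynomial_map_deg_le_mult[OF polynomial_map_mult_conjugation this]
  show "polynomial_map_deg_le 4 (quadratic_norm s)"
    by (simp add: quadratic_norm_def[abs_def])
qed

text \<open>For even \<open>p + q\<close> the center consists of scalars, so
  \<open>quadratic_norm\<close> is already scalar-valued.\<close>

lemma is_determinant_map_4:
  assumes n: "p + q = 4" and s: "s \<le> 1"
  shows "is_determinant_map (\<lambda>\<alpha>. (\<alpha> * conjugation s \<alpha>) * psi4 (\<alpha> * conjugation s \<alpha>))"
    and "is_determinant_map (\<lambda>\<alpha>. psi4 (conjugation s \<alpha> * \<alpha>) * (conjugation s \<alpha> * \<alpha>))"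
proof -
  have "p + q = 4 \<or> p + q = 5 \<and> s = 0" using n by simp
  note props = quadratic_norm_properties[OF this s]
  have det: "is_determinant_map (quadratic_norm s)"
  proof (rule is_determinant_mapI)
    show "\<exists>c. quadratic_norm s \<alpha> = scale c 1" for \<alpha>
      by (rule center_scalar[OF props(1)]) (simp add: n)
    show "\<exists>\<beta>. \<alpha> * \<beta> = quadratic_norm s \<alpha>" for \<alpha>
      unfolding quadratic_norm_def by (metis mult.assoc)
    show "\<exists>\<beta>. \<beta> * \<alpha> = quadratic_norm s \<alpha>" for \<alpha>
      using props(4)[of \<alpha>] by (metis mult.assoc)
  qed (use props n in simp_all)
  show "is_determinant_map (\<lambda>\<alpha>. (\<alpha> * conjugation s \<alpha>) * psi4 (\<alpha> * conjugation s \<alpha>))"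
    using det by (simp only: psi4_eq[OF n] quadratic_norm_def[abs_def])
  show "is_determinant_map (\<lambda>\<alpha>. psi4 (conjugation s \<alpha> * \<alpha>) * (conjugation s \<alpha> * \<alpha>))"
    using det by (simp only: psi4_eq[OF n] props(4))
qed

text \<open>The outer conjugation is \<open>clifford_conj\<close> because 5 + 10 is odd; reversion
  has exponent 10 and would fix the pseudoscalar.\<close>

lemma is_determinant_map_5:
  assumes n: "p + q = 5"
  shows "is_determinant_map (\<lambda>\<alpha>. ((\<alpha> * reversion \<alpha>) * psi5 (\<alpha> * reversion \<alpha>)) *
      clifford_conj ((\<alpha> * reversion \<alpha>) * psi5 (\<alpha> * reversion \<alpha>)))"
    and "is_determinant_map (\<lambda>\<alpha>. clifford_conj (psi5 (reversion \<alpha> * \<alpha>) * (reversion \<alpha> * \<alpha>)) *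
      (psi5 (reversion \<alpha> * \<alpha>) * (reversion \<alpha> * \<alpha>)))"
proof -
  have "p + q = 4 \<or> p + q = 5 \<and> 0 = (0::nat)" "0 \<le> (1::nat)" using n by simp_all
  note props = quadratic_norm_properties[OF this]
  have det: "is_determinant_map (\<lambda>\<alpha>. quadratic_norm 0 \<alpha> * conjugation 1 (quadratic_norm 0 \<alpha>))"
  proof (rule is_determinant_map_center_norm)
    show "\<exists>\<beta>. \<alpha> * \<beta> = quadratic_norm 0 \<alpha>" for \<alpha>
      unfolding quadratic_norm_def by (metis mult.assoc)
    show "\<exists>\<beta>. \<beta> * \<alpha> = quadratic_norm 0 \<alpha>" for \<alpha>
      using props(4)[of \<alpha>] by (metis mult.assoc)
    show "polynomial_map_deg_le 4 (quadratic_norm 0)"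
      by (rule props(5))
  qed (use props(1-3) n in \<open>simp_all add: choose_two\<close>)
  show "is_determinant_map (\<lambda>\<alpha>. ((\<alpha> * reversion \<alpha>) * psi5 (\<alpha> * reversion \<alpha>)) *
      clifford_conj ((\<alpha> * reversion \<alpha>) * psi5 (\<alpha> * reversion \<alpha>)))"
    using det by (simp only: psi5_eq[OF n] quadratic_norm_def reversion_eq clifford_conj_eq)
  have "conjugation 1 (quadratic_norm 0 \<alpha>) * quadratic_norm 0 \<alpha> =
      quadratic_norm 0 \<alpha> * conjugation 1 (quadratic_norm 0 \<alpha>)" for \<alpha>
    by (rule center_commute[OF conjugation_central[OF props(1)]])
  with det show "is_determinant_map (\<lambda>\<alpha>. clifford_conj (psi5 (reversion \<alpha> * \<alpha>) * (reversion \<alpha> * \<alpha>)) *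
      (psi5 (reversion \<alpha> * \<alpha>) * (reversion \<alpha> * \<alpha>)))"
    by (simp only: psi5_eq[OF n] props(4) reversion_eq clifford_conj_eq)
qed

end

lemma clifford_determinants:
  fixes scale :: "'k::field_char_0 \<Rightarrow> 'a::ring_1 \<Rightarrow> 'a"
  assumes "clifford_algebra scale e p q"
  shows "let det = finite_dimensional_algebra.is_determinant_map scale (blade e ` Pow {1..p + q});
         \<mu> = clifford_algebra.clifford_conj scale e p q;
         \<nu> = clifford_algebra.reversion scale e p q;
         \<psi>\<^sub>4 = clifford_algebra.psi4 scale e p q;
         \<psi>\<^sub>5 = clifford_algebra.psi5 scale e p q
     in
      (p + q = 1 \<or> p + q = 2 \<longrightarrow>
        det (\<lambda>\<alpha>. \<alpha> * \<mu> \<alpha>) \<and>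
        det (\<lambda>\<alpha>. \<mu> \<alpha> * \<alpha>)) \<and>
      (p + q = 3 \<longrightarrow>
        det (\<lambda>\<alpha>. (\<alpha> * \<mu> \<alpha>) * \<nu> (\<alpha> * \<mu> \<alpha>)) \<and>
        det (\<lambda>\<alpha>. \<nu> (\<mu> \<alpha> * \<alpha>) * (\<mu> \<alpha> * \<alpha>)) \<and>
        det (\<lambda>\<alpha>. (\<alpha> * \<nu> \<alpha>) * \<mu> (\<alpha> * \<nu> \<alpha>)) \<and>
        det (\<lambda>\<alpha>. \<mu> (\<nu> \<alpha> * \<alpha>) * (\<nu> \<alpha> * \<alpha>))) \<and>
      (p + q = 4 \<longrightarrow>
        det (\<lambda>\<alpha>. (\<alpha> * \<mu> \<alpha>) * \<psi>\<^sub>4 (\<alpha> * \<mu> \<alpha>)) \<and>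
        det (\<lambda>\<alpha>. \<psi>\<^sub>4 (\<mu> \<alpha> * \<alpha>) * (\<mu> \<alpha> * \<alpha>)) \<and>
        det (\<lambda>\<alpha>. (\<alpha> * \<nu> \<alpha>) * \<psi>\<^sub>4 (\<alpha> * \<nu> \<alpha>)) \<and>
        det (\<lambda>\<alpha>. \<psi>\<^sub>4 (\<nu> \<alpha> * \<alpha>) * (\<nu> \<alpha> * \<alpha>))) \<and>
      (p + q = 5 \<longrightarrow>
        det (\<lambda>\<alpha>. ((\<alpha> * \<nu> \<alpha>) * \<psi>\<^sub>5 (\<alpha> * \<nu> \<alpha>)) *
                  \<mu> ((\<alpha> * \<nu> \<alpha>) * \<psi>\<^sub>5 (\<alpha> * \<nu> \<alpha>))) \<and>
        det (\<lambda>\<alpha>. \<mu> (\<psi>\<^sub>5 (\<nu> \<alpha> * \<alpha>) * (\<nu> \<alpha> * \<alpha>)) *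
                  (\<psi>\<^sub>5 (\<nu> \<alpha> * \<alpha>) * (\<nu> \<alpha> * \<alpha>))))"
proof -
  interpret clifford_algebra_char_0 scale e p q
    using assms by (rule clifford_algebra_char_0.intro)
  note det_4 = is_determinant_map_4[of 1, OF _ order.refl, folded clifford_conj_eq]
    is_determinant_map_4[of 0, OF _ zero_le, folded reversion_eq]
  show ?thesis
    unfolding Let_def
    by (intro conjI impI)
      (rule is_determinant_map_1_2 is_determinant_map_3 det_4 is_determinant_map_5, assumption)+
qed

theorem theorem8p3:
  fixes p q :: nat
    and smultR :: "real \<Rightarrow> 'a::ring_1 \<Rightarrow> 'a" and eR :: "nat \<Rightarrow> 'a"
    and smultC :: "complex \<Rightarrow> 'b::ring_1 \<Rightarrow> 'b" and eC :: "nat \<Rightarrow> 'b"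
  assumes "1 \<le> p + q" and "p + q \<le> 5"
  shows "(clifford_algebra smultR eR p q \<longrightarrow>
    (let det = finite_dimensional_algebra.is_determinant_map smultR (blade eR ` Pow {1..p + q});
         \<mu> = clifford_algebra.clifford_conj smultR eR p q;
         \<nu> = clifford_algebra.reversion smultR eR p q;
         \<psi>\<^sub>4 = clifford_algebra.psi4 smultR eR p q;
         \<psi>\<^sub>5 = clifford_algebra.psi5 smultR eR p q
     in
      (p + q = 1 \<or> p + q = 2 \<longrightarrow>
        det (\<lambda>\<alpha>. \<alpha> * \<mu> \<alpha>) \<and>
        det (\<lambda>\<alpha>. \<mu> \<alpha> * \<alpha>)) \<and>
      (p + q = 3 \<longrightarrow>
        det (\<lambda>\<alpha>. (\<alpha> * \<mu> \<alpha>) * \<nu> (\<alpha> * \<mu> \<alpha>)) \<and>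
        det (\<lambda>\<alpha>. \<nu> (\<mu> \<alpha> * \<alpha>) * (\<mu> \<alpha> * \<alpha>)) \<and>
        det (\<lambda>\<alpha>. (\<alpha> * \<nu> \<alpha>) * \<mu> (\<alpha> * \<nu> \<alpha>)) \<and>
        det (\<lambda>\<alpha>. \<mu> (\<nu> \<alpha> * \<alpha>) * (\<nu> \<alpha> * \<alpha>))) \<and>
      (p + q = 4 \<longrightarrow>
        det (\<lambda>\<alpha>. (\<alpha> * \<mu> \<alpha>) * \<psi>\<^sub>4 (\<alpha> * \<mu> \<alpha>)) \<and>
        det (\<lambda>\<alpha>. \<psi>\<^sub>4 (\<mu> \<alpha> * \<alpha>) * (\<mu> \<alpha> * \<alpha>)) \<and>
        det (\<lambda>\<alpha>. (\<alpha> * \<nu> \<alpha>) * \<psi>\<^sub>4 (\<alpha> * \<nu> \<alpha>)) \<and>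
        det (\<lambda>\<alpha>. \<psi>\<^sub>4 (\<nu> \<alpha> * \<alpha>) * (\<nu> \<alpha> * \<alpha>))) \<and>
      (p + q = 5 \<longrightarrow>
        det (\<lambda>\<alpha>. ((\<alpha> * \<nu> \<alpha>) * \<psi>\<^sub>5 (\<alpha> * \<nu> \<alpha>)) *
                  \<mu> ((\<alpha> * \<nu> \<alpha>) * \<psi>\<^sub>5 (\<alpha> * \<nu> \<alpha>))) \<and>
        det (\<lambda>\<alpha>. \<mu> (\<psi>\<^sub>5 (\<nu> \<alpha> * \<alpha>) * (\<nu> \<alpha> * \<alpha>)) *
                  (\<psi>\<^sub>5 (\<nu> \<alpha> * \<alpha>) * (\<nu> \<alpha> * \<alpha>)))))) \<and>
   (clifford_algebra smultC eC p q \<longrightarrow>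
    (let det = finite_dimensional_algebra.is_determinant_map smultC (blade eC ` Pow {1..p + q});
         \<mu> = clifford_algebra.clifford_conj smultC eC p q;
         \<nu> = clifford_algebra.reversion smultC eC p q;
         \<psi>\<^sub>4 = clifford_algebra.psi4 smultC eC p q;
         \<psi>\<^sub>5 = clifford_algebra.psi5 smultC eC p q
     in
      (p + q = 1 \<or> p + q = 2 \<longrightarrow>
        det (\<lambda>\<alpha>. \<alpha> * \<mu> \<alpha>) \<and>
        det (\<lambda>\<alpha>. \<mu> \<alpha> * \<alpha>)) \<and>
      (p + q = 3 \<longrightarrow>
        det (\<lambda>\<alpha>. (\<alpha> * \<mu> \<alpha>) * \<nu> (\<alpha> * \<mu> \<alpha>)) \<and>
        det (\<lambda>\<alpha>. \<nu> (\<mu> \<alpha> * \<alpha>) * (\<mu> \<alpha> * \<alpha>)) \<and>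
        det (\<lambda>\<alpha>. (\<alpha> * \<nu> \<alpha>) * \<mu> (\<alpha> * \<nu> \<alpha>)) \<and>
        det (\<lambda>\<alpha>. \<mu> (\<nu> \<alpha> * \<alpha>) * (\<nu> \<alpha> * \<alpha>))) \<and>
      (p + q = 4 \<longrightarrow>
        det (\<lambda>\<alpha>. (\<alpha> * \<mu> \<alpha>) * \<psi>\<^sub>4 (\<alpha> * \<mu> \<alpha>)) \<and>
        det (\<lambda>\<alpha>. \<psi>\<^sub>4 (\<mu> \<alpha> * \<alpha>) * (\<mu> \<alpha> * \<alpha>)) \<and>
        det (\<lambda>\<alpha>. (\<alpha> * \<nu> \<alpha>) * \<psi>\<^sub>4 (\<alpha> * \<nu> \<alpha>)) \<and>
        det (\<lambda>\<alpha>. \<psi>\<^sub>4 (\<nu> \<alpha> * \<alpha>) * (\<nu> \<alpha> * \<alpha>))) \<and>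
      (p + q = 5 \<longrightarrow>
        det (\<lambda>\<alpha>. ((\<alpha> * \<nu> \<alpha>) * \<psi>\<^sub>5 (\<alpha> * \<nu> \<alpha>)) *
                  \<mu> ((\<alpha> * \<nu> \<alpha>) * \<psi>\<^sub>5 (\<alpha> * \<nu> \<alpha>))) \<and>
        det (\<lambda>\<alpha>. \<mu> (\<psi>\<^sub>5 (\<nu> \<alpha> * \<alpha>) * (\<nu> \<alpha> * \<alpha>)) *
                  (\<psi>\<^sub>5 (\<nu> \<alpha> * \<alpha>) * (\<nu> \<alpha> * \<alpha>))))))"
  by (intro conjI impI) (rule clifford_determinants, assumption)+

end
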